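(* Let $f\in L^1([-\pi,\pi])$ have real Fourier coefficients and be $2\pi$-periodically extended to $\mathbb{R}$. Let $Y_n\in\mathbb{R}^{n\times n}$ be the anti-identity matrix and let $T_n[f]\in\mathbb{R}^{n\times n}$ be the Toeplitz matrix generated by $f$. Then \[ \{Y_nT_n[f]\}_n\sim_\lambda \phi_{|f|} \] over the domain $[-2\pi,2\pi]$, where \[ \phi_{|f|}(\theta)=\begin{cases} |f(\theta)|, & \theta\in[0,2\pi],\\ -|f(-\theta)|, & \theta\in[-2\pi,0).\end{cases} \]
   Context: The function $f$ is complex-valued and Lebesgue integrable. Its Fourier coefficients are $a_k=\frac{1}{2\pi}\int_{-\pi}^{\pi}f(\theta)e^{-\mathbf{i}k\theta}\,d\theta$, $k\in\mathbb{Z}$. The Toeplitz matrix generated by $f$ is the $n\times n$ matrix with entries $[T_n[f]]_{s,t}=a_{s-t}$, $s,t\in\{1,\dots,n\}$. The anti-identity (flip) matrix $Y_n$ has entries $[Y_n]_{s,t}=1$ if $s+t=n+1$ and $0$ otherwise. Eigenvalue distribution: for $n\times n$ matrices $X_n$ and a measurable function $h:\Omega\subset\mathbb{R}\to\mathbb{C}$ with $0<\mu_1(\Omega)<\infty$ ($\mu_1$ Lebesgue measure), $\{X_n\}_n\sim_\lambda h$ over $\Omega$ means \[ \lim_{n\to\infty}\frac1n\sum_{j=1}^nF(\lambda_j(X_n))=\frac{1}{\mu_1(\Omega)}\int_\Omega F(h(\theta))\,d\theta \] for every complex-valued continuous $F$ on $\mathbb{C}$ with bounded support, where $\lambda_j(X_n)$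 are the eigenvalues of $X_n$ counted with multiplicity. *)

theory Defs
  imports
    "HOL-Analysis.Analysis"
    "HOL-Computational_Algebra.Fundamental_Theorem_Algebra"
    "Jordan_Normal_Form.Char_Poly"
begin

definition fourier_coeff :: "(real \<Rightarrow> complex) \<Rightarrow> int \<Rightarrow> complex" where
  "fourier_coeff f k =
     1 / (2 * complex_of_real pi) *
     (LINT \<theta>:{-pi..pi}|lebesgue. f \<theta> * exp (- (\<i> * of_int k * complex_of_real \<theta>)))"

text \<open>Matrix entries are indexed from 0 here; \<open>Suc i\<close> and \<open>Suc j\<close> are the usual row and
  column numbers in \<open>{1..n}\<close>.\<close>

definition toeplitz_mat :: "nat \<Rightarrow> (real \<Rightarrow> complex) \<Rightarrow> complex mat" where
  "toeplitz_mat n f = Matrix.mat n n (\<lambda>(i, j). fourier_coeff f (int (Suc i) - int (Suc j)))"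

definition flip_mat :: "nat \<Rightarrow> complex mat" where
  "flip_mat n = Matrix.mat n n (\<lambda>(i, j). if Suc i + Suc j = n + 1 then 1 else 0)"

definition eigenvalues_mset :: "complex mat \<Rightarrow> complex multiset" where
  "eigenvalues_mset A = proots (char_poly A)"

lemma set_eigenvalues_mset:
  assumes "A \<in> carrier_mat n n"
  shows "set_mset (eigenvalues_mset A) = {z. eigenvalue A z}"
proof -
  have "char_poly A \<noteq> 0"
    using degree_monic_char_poly[OF assms] by auto
  then show ?thesis
    by (auto simp: eigenvalues_mset_def eigenvalue_root_char_poly[OF assms])
qed

lemma size_eigenvalues_mset:
  assumes "A \<in> carrier_mat n n"
  shows "size (eigenvalues_mset A) = n"
  using degree_monic_char_poly[OF assms] by (simp add: eigenvalues_mset_def size_proots_complex)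

text \<open>The standing requirements on the matrices, the domain and the symbol are part of the
  definition. Boundedness of \<open>{z. F z \<noteq> 0}\<close> is the same as boundedness of its closure,
  the support of \<open>F\<close>.\<close>

definition eigenvalue_distribution ::
    "(nat \<Rightarrow> complex mat) \<Rightarrow> (real \<Rightarrow> complex) \<Rightarrow> real set \<Rightarrow> bool" where
  "eigenvalue_distribution X h \<Omega> \<longleftrightarrow>
     (\<forall>n. X n \<in> carrier_mat n n) \<and>
     \<Omega> \<in> lmeasurable \<and> 0 < measure lebesgue \<Omega> \<and>
     h \<in> borel_measurable (lebesgue_on \<Omega>) \<and>
     (\<forall>F :: complex \<Rightarrow> complex.
        continuous_on UNIV F \<longrightarrow> bounded {z. F z \<noteq> 0} \<longrightarrow>
        (\<lambda>n. 1 / of_nat n * (\<Sum>z\<in>#eigenvalues_mset (X n). F z))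
          \<longlonglongrightarrow> 1 / complex_of_real (measure lebesgue \<Omega>) * (LINT \<theta>:\<Omega>|lebesgue. F (h \<theta>)))"

text \<open>Only the values on \<open>{-2*pi..2*pi}\<close> matter.\<close>

definition phi :: "(real \<Rightarrow> real) \<Rightarrow> real \<Rightarrow> real" where
  "phi g \<theta> = (if \<theta> \<in> {0..2*pi} then g \<theta> else - g (- \<theta>))"

end

theory Submission
  imports Defs "Jordan_Normal_Form.Schur_Decomposition"
begin

text \<open>The matrices \<open>Y T[f]\<close> are real symmetric Hankel matrices. For a trigonometric polynomial with
  real coefficients their even powers are Toeplitz up to a bounded number of rows, with
  symbol \<open>\<bar>f\<bar>\<^sup>2\<^sup>m\<close>, while odd powers have bounded trace; so all moments, and hence all
  continuous averages, converge. For \<open>f \<in> L\<^sup>1\<close>, approximate \<open>f\<close> in \<open>L\<^sup>1\<close> by such polynomials.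
  The matrix of \<open>f - p\<close> has trace norm at most \<open>n \<parallel>f - p\<parallel>\<^sub>1 / 2\<pi>\<close>, and the test functions in the
  algebra generated by the resolvents \<open>1 / (x \<plusminus> \<i>)\<close> have traces that are Lipschitz in the trace norm.
  Through the Cayley transform and the Weierstrass theorem on the circle, this algebra is
  uniformly dense among the continuous functions of compact support.\<close>

subsection \<open>Unitary diagonalization of Hermitian matrices\<close>

text \<open>The symbol \<open>f\<close> is complex in general: real coefficients only force f(-t) =
  cnj (f t) almost everywhere. A flipped Toeplitz matrix acts roughly like multiplication by f
  followed by a reflection. Two such factors give f cnj f = |f|^2, while an odd number leaves a
  reflection, whose trace is negligible. The limit law is therefore symmetric, with half of its mass
  on |f| and half on -|f|; this is the origin of the sign in \<open>phi\<close> and of the doubled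
  domain. The obstacle is that moments are useless for merely integrable \<open>f\<close>: powers of
  |f| need not be integrable, and the spectra need not stay in a fixed interval. The passage from
  polynomials to \<open>f\<close> needs test functions whose traces are stable in the trace norm,
  which a continuous function of compact support need not be. The resolvent 1/(x - z) is stable by
  the resolvent identity, and sums and products of bounded stable functions are stable. The
  estimates are uniform in n because the factor n in the trace norm is cancelled by averaging over n
  eigenvalues.\<close>

lemma mat_adjoint_carrier:
  "A \<in> carrier_mat n m \<Longrightarrow> mat_adjoint A \<in> carrier_mat m n"
  by (auto simp: mat_adjoint_def)

lemma index_mat_adjoint:
  fixes A :: "complex mat"
  assumes "A \<in> carrier_mat n m" "i < m" "j < n"
  shows "mat_adjoint A $$ (i, j) = cnj (A $$ (j, i))"
  using assms by (simp add: mat_adjoint_def mat_of_rows_index)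

lemma mat_adjoint_mult:
  fixes A B :: "complex mat"
  assumes "A \<in> carrier_mat n m" "B \<in> carrier_mat m k"
  shows "mat_adjoint (A * B) = mat_adjoint B * mat_adjoint A"
proof (rule eq_matI)
  fix i j assume ij: "i < dim_row (mat_adjoint B * mat_adjoint A)" "j < dim_col (mat_adjoint B * mat_adjoint A)"
  then have i: "i < k" and j: "j < n"
    using mat_adjoint_carrier[OF assms(1)] mat_adjoint_carrier[OF assms(2)] by auto
  show "mat_adjoint (A * B) $$ (i, j) = (mat_adjoint B * mat_adjoint A) $$ (i, j)"
    using assms i j mat_adjoint_carrier[OF assms(1)] mat_adjoint_carrier[OF assms(2)]
    by (simp add: index_mat_adjoint[of "A * B" n k] scalar_prod_def index_mat_adjoint[of A n m]
        index_mat_adjoint[of B m k] mult.commute)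
qed (use assms mat_adjoint_carrier[OF assms(1)] mat_adjoint_carrier[OF assms(2)]
      mat_adjoint_carrier[of "A * B" n k] in auto)

lemma mat_adjoint_adjoint:
  fixes A :: "complex mat"
  assumes "A \<in> carrier_mat n m"
  shows "mat_adjoint (mat_adjoint A) = A"
  using assms mat_adjoint_carrier[OF assms] mat_adjoint_carrier[OF mat_adjoint_carrier[OF assms]]
  by (intro eq_matI) (auto simp: index_mat_adjoint[of "mat_adjoint A" m n] index_mat_adjoint[of A n m])

text \<open>Gram-Schmidt applied to a basis that starts with \<open>v\<close> keeps \<open>v\<close>
  in front but yields orthogonal vectors of arbitrary length. Dividing each by its norm
  \<open>nrm\<close> makes the columns orthonormal and only rescales the first one.\<close>

lemma exists_unitary_first_col:
  fixes v :: "complex vec"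
  assumes v: "v \<in> carrier_vec n" "v \<noteq> 0\<^sub>v n" and n: "n \<noteq> 0"
  obtains W c where "W \<in> carrier_mat n n" "mat_adjoint W * W = 1\<^sub>m n" "col W 0 = c \<cdot>\<^sub>v v"
proof -
  interpret cof_vec_space n "TYPE(complex)" .
  define b where "b = basis_completion v"
  define ws where "ws = gram_schmidt n b"
  from basis_completion[OF v, folded b_def]
  have dist_b: "distinct b" 
    and indep: "\<not> lin_dep (set b)" and b: "set b \<subseteq> carrier_vec n" and hdb: "hd b = v" 
    and len_b: "length b = n" by auto
  from hdb len_b n obtain vs where bv: "b = v # vs" by (cases b, auto)
  from gram_schmidt_result[OF b dist_b indep refl, folded ws_def]
  have ws: "set ws \<subseteq> carrier_vec n" "corthogonal ws" "length ws = n" 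
    by (auto simp: len_b)
  from gram_schmidt_hd[OF v(1), of vs, folded bv] have hdws: "hd ws = v" unfolding ws_def .
  have ws0: "ws ! 0 = v" using hdws ws(3) n by (cases ws) auto
  define nrm :: "complex vec \<Rightarrow> real" where "nrm w = sqrt (\<Sum>i<n. (cmod (w $ i))\<^sup>2)" for w
  have nrm: "w \<bullet>c w = complex_of_real (nrm w ^ 2)" if "w \<in> carrier_vec n" for w
  proof -
    have "w \<bullet>c w = (\<Sum>i<n. w $ i * cnj (w $ i))"
      using that by (simp add: scalar_prod_def lessThan_atLeast0)
    also have "\<dots> = complex_of_real (\<Sum>i<n. (cmod (w $ i))\<^sup>2)"
      by (simp add: complex_norm_square[symmetric])
    finally show ?thesis by (simp add: nrm_def sum_nonneg)
  qed
  define W where "W = mat n n (\<lambda>(i, j). ws ! j $ i / nrm (ws ! j))"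
  have W: "W \<in> carrier_mat n n" by (simp add: W_def)
  have wsj: "ws ! j \<in> carrier_vec n" if "j < n" for j using that ws by auto
  have orth: "(\<Sum>k<n. cnj (ws ! i $ k) * ws ! j $ k) = (if i = j then complex_of_real (nrm (ws ! j) ^ 2) else 0)"
    if "i < n" "j < n" for i j
  proof -
    have "(\<Sum>k<n. cnj (ws ! i $ k) * ws ! j $ k) = ws ! j \<bullet>c ws ! i"
      using wsj[OF that(1)] wsj[OF that(2)] by (simp add: scalar_prod_def lessThan_atLeast0 mult.commute)
    then show ?thesis using that corthogonalD[OF ws(2)] ws(3) nrm[OF wsj[OF that(2)]] by auto
  qed
  have nz: "nrm (ws ! j) \<noteq> 0" if "j < n" for j
    using corthogonalD[OF ws(2), of j j] that ws(3) nrm[OF wsj[OF that]] by auto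
  have "mat_adjoint W * W = 1\<^sub>m n"
  proof (rule eq_matI)
    fix i j assume "i < dim_row (1\<^sub>m n :: complex mat)" "j < dim_col (1\<^sub>m n :: complex mat)"
    then have i: "i < n" and j: "j < n" by auto
    have "(mat_adjoint W * W) $$ (i, j) = (\<Sum>k<n. cnj (W $$ (k, i)) * W $$ (k, j))"
      using W mat_adjoint_carrier[OF W] i j
      by (simp add: scalar_prod_def lessThan_atLeast0 index_mat_adjoint[OF W])
    also have "\<dots> = (\<Sum>k<n. cnj (ws ! i $ k) * ws ! j $ k / (nrm (ws ! i) * nrm (ws ! j)))"
      using i j by (intro sum.cong) (simp_all add: W_def)
    also have "\<dots> = (\<Sum>k<n. cnj (ws ! i $ k) * ws ! j $ k) / (nrm (ws ! i) * nrm (ws ! j))"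
      by (simp add: sum_divide_distrib)
    also have "\<dots> = 1\<^sub>m n $$ (i, j)"
      using i j nz by (simp add: orth power2_eq_square)
    finally show "(mat_adjoint W * W) $$ (i, j) = 1\<^sub>m n $$ (i, j)" .
  qed (use W mat_adjoint_carrier[OF W] in auto)
  moreover have "col W 0 = (1 / nrm v) \<cdot>\<^sub>v v"
    using n v by (intro eq_vecI) (auto simp: W_def ws0)
  ultimately show ?thesis using W that by blast
qed

text \<open>Deflation: a unitary whose first column is an eigenvector splits off a 1 by 1 block, and
  the remaining Hermitian block has the remaining linear factors. Fixing the list \<open>es\<close>
  in advance ties the diagonal to the roots of \<open>char_poly\<close> with multiplicity.\<close>

theorem hermitian_unitary_diagonalization:
  fixes A :: "complex mat"
  assumes "A \<in> carrier_mat n n" "mat_adjoint A = A" "char_poly A = (\<Prod>e\<leftarrow>es. [:- e, 1:])"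
  shows "\<exists>P \<in> carrier_mat n n. mat_adjoint P * P = 1\<^sub>m n \<and>
           mat_adjoint P * A * P = mat n n (\<lambda>(i, j). if i = j then es ! i else 0)"
  using assms
proof (induction es arbitrary: n A)
  case Nil
  with degree_monic_char_poly[of A n] have "n = 0" by simp
  then show ?case by (intro bexI[of _ "1\<^sub>m 0"] conjI eq_matI) (auto simp: mat_adjoint_def)
next
  case (Cons e es n A)
  note A = Cons.prems(1)
  have cp: "char_poly A = [: -e, 1 :] * (\<Prod>e \<leftarrow> es. [:- e, 1:])" using Cons.prems(3) by simp
  have mon: "monic (\<Prod>e\<leftarrow> es. [:- e, 1:])" by (rule monic_prod_list, auto)
  have deg: "degree (char_poly A) = Suc (degree (\<Prod>e\<leftarrow> es. [:- e, 1:]))" unfolding cp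
    by (subst degree_mult_eq, insert mon, auto)
  with degree_monic_char_poly[OF A] have n: "n \<noteq> 0" by auto
  then obtain m where m: "n = Suc m" by (cases n) auto
  have "eigenvalue A e" 
    unfolding eigenvalue_root_char_poly[OF A] cp by simp
  then obtain v where v: "v \<in> carrier_vec n" "v \<noteq> 0\<^sub>v n" and Av: "A *\<^sub>v v = e \<cdot>\<^sub>v v"
    using A unfolding eigenvalue_def eigenvector_def by auto
  obtain W c where W: "W \<in> carrier_mat n n" and WW: "mat_adjoint W * W = 1\<^sub>m n" and W0: "col W 0 = c \<cdot>\<^sub>v v"
    using exists_unitary_first_col[OF v n] by metis
  let ?W = "mat_adjoint W"
  have W': "?W \<in> carrier_mat n n" by (rule mat_adjoint_carrier[OF W])
  have WW': "W * ?W = 1\<^sub>m n" using mat_mult_left_right_inverse[OF W' W WW] .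
  define B where "B = ?W * A * W"
  have B: "B \<in> carrier_mat n n" using W W' A by (simp add: B_def)
  have AdB: "mat_adjoint B = B"
    using W W' A Cons.prems(2) assoc_mult_mat[OF W' A W]
    by (simp add: B_def mat_adjoint_mult[of _ n n _ n] mat_adjoint_adjoint[OF W])
  have B_sym: "B $$ (i, j) = cnj (B $$ (j, i))" if "i < n" "j < n" for i j
    using index_mat_adjoint[OF B, of i j] that AdB by simp
  have A_W0: "A *\<^sub>v col W 0 = e \<cdot>\<^sub>v col W 0"
    using A v Av by (simp add: W0 mult_mat_vec smult_smult_assoc mult.commute)
  have "col B 0 = ?W *\<^sub>v (A *\<^sub>v col W 0)"
    using n W W' A col_mult2[of "?W * A" n n W n 0]
    by (simp add: B_def assoc_mult_mat_vec[of ?W n n A n])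
  also have "\<dots> = e \<cdot>\<^sub>v (?W *\<^sub>v col W 0)"
    using W W' n by (simp add: A_W0 mult_mat_vec[of ?W n n "col W 0"] carrier_vecI)
  also have "?W *\<^sub>v col W 0 = col (1\<^sub>m n) 0"
    using n W W' col_mult2[of "?W" n n W n 0] by (simp add: WW)
  finally have colB: "col B 0 = e \<cdot>\<^sub>v unit_vec n 0" using n by simp
  have B_col: "B $$ (i, 0) = (if i = 0 then e else 0)" if "i < n" for i
    using that arg_cong[OF colB, of "\<lambda>v. v $ i"] B n by auto
  \<comment> \<open>The Hermitian hypothesis enters here: the zeros of the first column reappear in
    the first row, so \<open>B\<close> is block diagonal and not just block triangular.\<close>
  have B_row: "B $$ (0, i) = (if i = 0 then e else 0)" if "i < n" for i
    using B_sym[of 0 i] B_sym[of 0 0] B_col[OF that] B_col[of 0] that n by (auto split: if_splits)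
  define C where "C = mat m m (\<lambda>(i, j). B $$ (Suc i, Suc j))"
  have C: "C \<in> carrier_mat m m" by (simp add: C_def)
  define E where "E = mat 1 1 (\<lambda>_. e)"
  have E: "E \<in> carrier_mat 1 1" by (simp add: E_def)
  have B_block: "B = four_block_mat E (0\<^sub>m 1 m) (0\<^sub>m m 1) C"
    using B m by (intro eq_matI) (auto simp: B_col B_row C_def E_def)
  have AdC: "mat_adjoint C = C"
  proof (rule eq_matI)
    fix i j assume "i < dim_row C" "j < dim_col C"
    then have ij: "i < m" "j < m" using C by auto
    show "mat_adjoint C $$ (i, j) = C $$ (i, j)"
      using ij m B_sym[of "Suc i" "Suc j"] by (simp add: index_mat_adjoint[OF C]) (simp add: C_def)
  qed (use C mat_adjoint_carrier[OF C] in auto)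
  have "similar_mat A B"
    unfolding similar_mat_def
    by (intro exI[of _ W] exI[of _ ?W] similar_mat_witI[of _ _ n])
       (use W W' A B WW WW' in \<open>auto simp: B_def assoc_mult_mat[of _ n n _ n _ n] simp flip: assoc_mult_mat[of W n n ?W n _ n]\<close>)
  then have "char_poly A = char_poly E * char_poly C"
    using char_poly_similar char_poly_four_block_zeros_col[OF E _ C, of "0\<^sub>m 1 m"] B_block by fastforce
  moreover have "char_poly E = [: -e, 1 :]"
    by (simp add: E_def char_poly_defs det_def sign_def)
  ultimately have cpC: "char_poly C = (\<Prod>e \<leftarrow> es. [:- e, 1:])"
    using cp by (metis mult_cancel_left pCons_eq_0_iff zero_neq_one)
  obtain Q where Q: "Q \<in> carrier_mat m m" and QQ: "mat_adjoint Q * Q = 1\<^sub>m m"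
    and QCQ: "mat_adjoint Q * C * Q = mat m m (\<lambda>(i, j). if i = j then es ! i else 0)"
    using Cons.IH[OF C AdC cpC] by blast
  have Q': "mat_adjoint Q \<in> carrier_mat m m" by (rule mat_adjoint_carrier[OF Q])
  define R where "R = four_block_mat (1\<^sub>m 1) (0\<^sub>m 1 m) (0\<^sub>m m 1) Q"
  have R: "R \<in> carrier_mat n n" using Q m by (auto simp: R_def)
  have R': "mat_adjoint R \<in> carrier_mat n n" by (rule mat_adjoint_carrier[OF R])
  have AdR: "mat_adjoint R = four_block_mat (1\<^sub>m 1) (0\<^sub>m 1 m) (0\<^sub>m m 1) (mat_adjoint Q)"
  proof (rule eq_matI)
    fix i j
    assume "i < dim_row (four_block_mat (1\<^sub>m 1) (0\<^sub>m 1 m) (0\<^sub>m m 1) (mat_adjoint Q))"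
      "j < dim_col (four_block_mat (1\<^sub>m 1) (0\<^sub>m 1 m) (0\<^sub>m m 1) (mat_adjoint Q))"
    then have ij: "i < n" "j < n" using Q' m by auto
    show "mat_adjoint R $$ (i, j) =
        four_block_mat (1\<^sub>m 1) (0\<^sub>m 1 m) (0\<^sub>m m 1) (mat_adjoint Q) $$ (i, j)"
      using ij m Q Q'
      by (subst index_mat_adjoint[OF R]) (auto simp: R_def index_mat_adjoint[OF Q])
  qed (use R' Q' m in auto)
  have RR: "mat_adjoint R * R = 1\<^sub>m n"
    unfolding AdR
    unfolding R_def
    by (subst mult_four_block_mat[of _ 1 1 _ m _ m _ _ 1 _ m])
       (use Q Q' QQ m in \<open>auto simp: intro!: eq_matI\<close>)
  have RBR: "mat_adjoint R * B * R = four_block_mat E (0\<^sub>m 1 m) (0\<^sub>m m 1) (mat_adjoint Q * C * Q)"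
  proof -
    have "mat_adjoint R * B = four_block_mat E (0\<^sub>m 1 m) (0\<^sub>m m 1) (mat_adjoint Q * C)"
      unfolding AdR B_block
      by (subst mult_four_block_mat[of _ 1 1 _ m _ m _ _ 1 _ m]) (use Q' C E in auto)
    moreover have "four_block_mat E (0\<^sub>m 1 m) (0\<^sub>m m 1) (mat_adjoint Q * C) * R =
        four_block_mat E (0\<^sub>m 1 m) (0\<^sub>m m 1) (mat_adjoint Q * C * Q)"
      unfolding R_def
      by (subst mult_four_block_mat[of _ 1 1 _ m _ m _ _ 1 _ m]) (use Q Q' C E in auto)
    ultimately show ?thesis by simp
  qed
  define P where "P = W * R"
  have P: "P \<in> carrier_mat n n" using W R by (simp add: P_def)
  have AdP: "mat_adjoint P = mat_adjoint R * ?W" unfolding P_def by (rule mat_adjoint_mult[OF W R])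
  have "mat_adjoint P * P = mat_adjoint R * (?W * W) * R"
    unfolding AdP unfolding P_def using R R' W W' by (simp add: assoc_mult_mat[of _ n n _ n _ n])
  then have PP: "mat_adjoint P * P = 1\<^sub>m n" using WW RR R' by simp
  have "mat_adjoint P * A * P = mat_adjoint R * B * R"
    unfolding AdP unfolding P_def B_def using R R' W W' A by (simp add: assoc_mult_mat[of _ n n _ n _ n])
  also have "\<dots> = mat n n (\<lambda>(i, j). if i = j then (e # es) ! i else 0)"
    unfolding RBR QCQ using m by (intro eq_matI) (auto simp: E_def)
  finally show ?case using P PP by blast
qed

text \<open>The first index numbers the vectors, the second their coordinates. Orthonormality and
  completeness are stored together so that Parseval is available in both directions; plain functions
  let sums be swapped without carrier conditions.\<close>

definition unitary_array :: "nat \<Rightarrow> (nat \<Rightarrow> nat \<Rightarrow> complex) \<Rightarrow> bool" where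
  "unitary_array n u \<longleftrightarrow>
     (\<forall>i<n. \<forall>j<n. (\<Sum>s<n. u i s * cnj (u j s)) = (if i = j then 1 else 0)) \<and>
     (\<forall>s<n. \<forall>t<n. (\<Sum>i<n. u i s * cnj (u i t)) = (if s = t then 1 else 0))"

definition eigenbasis ::
  "nat \<Rightarrow> (nat \<Rightarrow> nat \<Rightarrow> complex) \<Rightarrow> (nat \<Rightarrow> nat \<Rightarrow> complex) \<Rightarrow> (nat \<Rightarrow> real) \<Rightarrow> bool" where
  "eigenbasis n a u l \<longleftrightarrow> unitary_array n u \<and>
     (\<forall>i<n. \<forall>s<n. (\<Sum>t<n. a s t * u i t) = l i * u i s)"

text \<open>The eigenvectors are the columns of the diagonalizing unitary, hence the exchanged
  indices in \<open>u\<close>. The second conclusion is the bridge from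
  \<open>eigenvalues_mset\<close> to sums over real numbers \<open>l i\<close>.\<close>

lemma hermitian_eigenbasis:
  assumes sym: "\<And>s t. s < n \<Longrightarrow> t < n \<Longrightarrow> a t s = cnj (a s t)"
  obtains u l where "eigenbasis n a u l"
    "eigenvalues_mset (mat n n (\<lambda>(s, t). a s t)) = image_mset (\<lambda>i. complex_of_real (l i)) (mset_set {..<n})"
proof -
  define A where "A = mat n n (\<lambda>(s, t). a s t)"
  have A: "A \<in> carrier_mat n n" by (simp add: A_def)
  have AdA: "mat_adjoint A = A"
  proof (rule eq_matI)
    fix i j assume "i < dim_row A" "j < dim_col A"
    then have ij: "i < n" "j < n" using A by auto
    show "mat_adjoint A $$ (i, j) = A $$ (i, j)"
      using ij sym[of i j] by (simp add: index_mat_adjoint[OF A]) (simp add: A_def)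
  qed (use A mat_adjoint_carrier[OF A] in auto)
  obtain es where es: "char_poly A = (\<Prod>e\<leftarrow>es. [:- e, 1:])" and len: "length es = n"
    using char_poly_factorized[OF A] by blast
  obtain P where P: "P \<in> carrier_mat n n" and PP: "mat_adjoint P * P = 1\<^sub>m n" and
    PAP: "mat_adjoint P * A * P = mat n n (\<lambda>(i, j). if i = j then es ! i else 0)" (is "_ = ?D")
    using hermitian_unitary_diagonalization[OF A AdA es] by blast
  let ?P = "mat_adjoint P"
  have P': "?P \<in> carrier_mat n n" by (rule mat_adjoint_carrier[OF P])
  have PP': "P * ?P = 1\<^sub>m n" using mat_mult_left_right_inverse[OF P' P PP] .
  define u where "u i s = P $$ (s, i)" for i s
  have "(\<Sum>s<n. u i s * cnj (u j s)) = (if i = j then 1 else 0)" if "i < n" "j < n" for i j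
  proof -
    have "(\<Sum>s<n. u i s * cnj (u j s)) = (?P * P) $$ (j, i)"
      using that P P' by (simp add: u_def scalar_prod_def index_mat_adjoint[OF P] lessThan_atLeast0 mult.commute)
    then show ?thesis using that PP by simp
  qed
  moreover have "(\<Sum>i<n. u i s * cnj (u i t)) = (if s = t then 1 else 0)" if "s < n" "t < n" for s t
  proof -
    have "(\<Sum>i<n. u i s * cnj (u i t)) = (P * ?P) $$ (s, t)"
      using that P P' by (simp add: u_def scalar_prod_def index_mat_adjoint[OF P] lessThan_atLeast0)
    then show ?thesis using that PP' by simp
  qed
  ultimately have U: "unitary_array n u" by (simp add: unitary_array_def)
  \<comment> \<open>A unitary conjugate of a Hermitian matrix is Hermitian, so its diagonal entries
    \<open>es ! i\<close> equal their conjugates.\<close>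
  have D_herm: "mat_adjoint ?D = ?D"
    unfolding PAP[symmetric] using P P' A assoc_mult_mat[OF P' A P]
    by (simp add: mat_adjoint_mult[of _ n n _ n] mat_adjoint_adjoint[OF P] AdA)
  have es_real: "es ! i = complex_of_real (Re (es ! i))" if "i < n" for i
  proof -
    have "cnj (es ! i) = mat_adjoint ?D $$ (i, i)"
      using that by (subst index_mat_adjoint[of ?D n n]) auto
    then have "cnj (es ! i) = es ! i" unfolding D_herm using that by simp
    then show ?thesis by (simp add: complex_eq_iff)
  qed
  define l where "l i = Re (es ! i)" for i
  have "A * P = P * ?D"
  proof -
    have "P * ?D = (P * ?P) * (A * P)"
      unfolding PAP[symmetric] using P P' A by (simp add: assoc_mult_mat[of _ n n _ n _ n] del: PP')
    then show ?thesis using PP' A P by simp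
  qed
  then have AP: "(A * P) $$ (s, i) = (P * ?D) $$ (s, i)" for s i by simp
  have "(\<Sum>t<n. a s t * u i t) = l i * u i s" if "i < n" "s < n" for i s
  proof -
    have "(\<Sum>t<n. a s t * u i t) = (A * P) $$ (s, i)"
      using that P A by (simp add: scalar_prod_def u_def A_def lessThan_atLeast0)
    also have "\<dots> = (\<Sum>t<n. P $$ (s, t) * (if t = i then es ! i else 0))"
      unfolding AP using that P
      by (auto simp add: scalar_prod_def lessThan_atLeast0 intro!: sum.cong)
    also have "\<dots> = l i * u i s"
      using that es_real[OF that(1)] by (simp add: u_def l_def if_distrib cong: if_cong)
    finally show ?thesis .
  qed
  then have "eigenbasis n a u l" using U by (simp add: eigenbasis_def)
  moreover have "eigenvalues_mset A = image_mset (\<lambda>i. complex_of_real (l i)) (mset_set {..<n})"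
  proof -
    have "proots (\<Prod>e\<leftarrow>es'. [:- e, 1:]) = mset es'" for es' :: "complex list"
    proof (induction es')
      case (Cons e es')
      have "(\<Prod>e\<leftarrow>es'. [:- e, 1:]) \<noteq> 0" by (simp add: prod_list_zero_iff image_iff)
      then show ?case using Cons by (simp add: proots_mult del: mult_pCons_left)
    qed simp
    then have "eigenvalues_mset A = mset es" by (simp add: eigenvalues_mset_def es)
    also have "es = map (\<lambda>i. complex_of_real (l i)) [0..<n]"
      using len es_real by (intro nth_equalityI) (auto simp: l_def)
    also have "mset \<dots> = image_mset (\<lambda>i. complex_of_real (l i)) (mset_set {..<n})"
      by (simp add: lessThan_atLeast0)
    finally show ?thesis .
  qed
  ultimately show ?thesis using that by (simp add: A_def)
qed

subsection \<open>Trace perturbation\<close>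

lemma unitary_array_parseval:
  assumes "unitary_array n u"
  shows "(\<Sum>s<n. (cmod (\<Sum>i<n. u i s * x i))\<^sup>2) = (\<Sum>i<n. (cmod (x i))\<^sup>2)"
proof -
  have "complex_of_real (\<Sum>s<n. (cmod (\<Sum>i<n. u i s * x i))\<^sup>2)
      = (\<Sum>s<n. (\<Sum>i<n. u i s * x i) * cnj (\<Sum>j<n. u j s * x j))"
    by (simp only: of_real_sum complex_norm_square)
  also have "\<dots> = (\<Sum>s<n. \<Sum>i<n. \<Sum>j<n. x i * cnj (x j) * (u i s * cnj (u j s)))"
    by (simp add: sum_product mult_ac)
  also have "\<dots> = (\<Sum>i<n. \<Sum>j<n. \<Sum>s<n. x i * cnj (x j) * (u i s * cnj (u j s)))"
    by (subst sum.swap, rule sum.cong, rule refl, rule sum.swap)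
  also have "\<dots> = (\<Sum>i<n. \<Sum>j<n. x i * cnj (x j) * (if i = j then 1 else 0))"
    using assms unfolding unitary_array_def by (simp flip: sum_distrib_left)
  also have "\<dots> = (\<Sum>i<n. x i * cnj (x i))"
    by (simp add: if_distrib cong: if_cong)
  also have "\<dots> = complex_of_real (\<Sum>i<n. (cmod (x i))\<^sup>2)"
    by (simp only: of_real_sum complex_norm_square)
  finally show ?thesis unfolding of_real_eq_iff .
qed

text \<open>Turns Parseval for synthesis from coefficients into Parseval for the coefficients of a
  given vector.\<close>

lemma unitary_array_swap: "unitary_array n u \<Longrightarrow> unitary_array n (\<lambda>s i. u i s)"
  by (auto simp: unitary_array_def)

lemma unitary_array_cnj:
  assumes "unitary_array n u"
  shows "unitary_array n (\<lambda>i s. cnj (u i s))"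
proof -
  have 1: "(\<Sum>s<n. cnj (u i s) * u j s) = cnj (\<Sum>s<n. u i s * cnj (u j s))" for i j
    by simp
  have 2: "(\<Sum>i<n. cnj (u i s) * u i t) = cnj (\<Sum>i<n. u i s * cnj (u i t))" for s t
    by simp
  show ?thesis using assms unfolding unitary_array_def
    by (simp add: 1 2)
qed

lemma cauchy_schwarz_cmod:
  "cmod (\<Sum>s\<in>S. a s * b s) \<le> sqrt (\<Sum>s\<in>S. (cmod (a s))\<^sup>2) * sqrt (\<Sum>s\<in>S. (cmod (b s))\<^sup>2)"
proof -
  have "cmod (\<Sum>s\<in>S. a s * b s) \<le> (\<Sum>s\<in>S. \<bar>cmod (a s)\<bar> * \<bar>cmod (b s)\<bar>)"
    by (rule order_trans[OF norm_sum]) (simp add: norm_mult)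
  also have "\<dots> \<le> L2_set (\<lambda>s. cmod (a s)) S * L2_set (\<lambda>s. cmod (b s)) S"
    by (rule L2_set_mult_ineq)
  finally show ?thesis by (simp add: L2_set_def)
qed

text \<open>In the matrix element of a - b between \<open>u i\<close> and \<open>v j\<close>, the
  Hermitian \<open>a\<close> acts to the left and \<open>b\<close> to the right. The factor
  \<open>l i - m j\<close> appears as a product and never as a denominator, so coinciding
  eigenvalues need no special treatment.\<close>

lemma eigenbasis_cross:
  assumes u: "eigenbasis n a u l" and v: "eigenbasis n b v m"
    and herm: "\<And>s t. s < n \<Longrightarrow> t < n \<Longrightarrow> a t s = cnj (a s t)"
    and ij: "i < n" "j < n"
  shows "(l i - m j) * (\<Sum>s<n. cnj (u i s) * v j s) =
           (\<Sum>s<n. \<Sum>t<n. cnj (u i s) * (a s t - b s t) * v j t)"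
proof -
  have "l i * cnj (u i s) = (\<Sum>t<n. cnj (u i t) * a t s)" if "s < n" for s
  proof -
    have "l i * cnj (u i s) = cnj (l i * u i s)" by simp
    also have "\<dots> = cnj (\<Sum>t<n. a s t * u i t)" using u ij that by (simp add: eigenbasis_def)
    also have "\<dots> = (\<Sum>t<n. cnj (u i t) * a t s)"
      unfolding cnj_sum
    proof (rule sum.cong[OF refl])
      fix t assume "t \<in> {..<n}"
      then have "a t s = cnj (a s t)" using herm that by blast
      then show "cnj (a s t * u i t) = cnj (u i t) * a t s" by simp
    qed
    finally show ?thesis .
  qed
  then have "l i * (\<Sum>s<n. cnj (u i s) * v j s) = (\<Sum>s<n. (\<Sum>t<n. cnj (u i t) * a t s) * v j s)"
    by (simp add: sum_distrib_left flip: mult.assoc)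
  also have "\<dots> = (\<Sum>s<n. \<Sum>t<n. cnj (u i s) * a s t * v j t)"
    by (subst sum.swap) (simp add: sum_distrib_right)
  finally have 1: "l i * (\<Sum>s<n. cnj (u i s) * v j s) = (\<Sum>s<n. \<Sum>t<n. cnj (u i s) * a s t * v j t)" .
  have "m j * (\<Sum>s<n. cnj (u i s) * v j s) = (\<Sum>s<n. cnj (u i s) * (m j * v j s))"
    by (simp add: sum_distrib_left mult_ac)
  also have "\<dots> = (\<Sum>s<n. cnj (u i s) * (\<Sum>t<n. b s t * v j t))"
    using v ij by (intro sum.cong) (auto simp: eigenbasis_def)
  also have "\<dots> = (\<Sum>s<n. \<Sum>t<n. cnj (u i s) * b s t * v j t)"
    by (simp add: sum_distrib_left mult_ac)
  finally have 2: "m j * (\<Sum>s<n. cnj (u i s) * v j s) = (\<Sum>s<n. \<Sum>t<n. cnj (u i s) * b s t * v j t)" .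
  show ?thesis by (simp add: left_diff_distrib right_diff_distrib 1 2 sum_subtractf)
qed

text \<open>\<open>K\<close> bounds the operator norm of the array \<open>M\<close>, written without conjugates so that
  it pairs directly with Hankel forms.\<close>

definition bilinear_bound :: "nat \<Rightarrow> real \<Rightarrow> (nat \<Rightarrow> nat \<Rightarrow> complex) \<Rightarrow> bool" where
  "bilinear_bound n K M \<longleftrightarrow>
     (\<forall>x y. cmod (\<Sum>s<n. \<Sum>t<n. M s t * x s * y t)
        \<le> K * sqrt (\<Sum>s<n. (cmod (x s))\<^sup>2) * sqrt (\<Sum>s<n. (cmod (y s))\<^sup>2))"

lemma bilinear_bound_sum:
  fixes r :: nat and K :: real
  assumes "\<And>k. k < r \<Longrightarrow> bilinear_bound n K (M k)"
  shows "bilinear_bound n (r * K) (\<lambda>s t. \<Sum>k<r. M k s t)"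
  unfolding bilinear_bound_def
proof (intro allI)
  fix x y :: "nat \<Rightarrow> complex"
  have "(\<Sum>s<n. \<Sum>t<n. (\<Sum>k<r. M k s t) * x s * y t) = (\<Sum>s<n. \<Sum>t<n. \<Sum>k<r. M k s t * x s * y t)"
    by (simp add: sum_distrib_right)
  also have "\<dots> = (\<Sum>s<n. \<Sum>k<r. \<Sum>t<n. M k s t * x s * y t)"
    by (rule sum.cong, rule refl, rule sum.swap)
  also have "\<dots> = (\<Sum>k<r. \<Sum>s<n. \<Sum>t<n. M k s t * x s * y t)"
    by (rule sum.swap)
  also have "cmod \<dots> \<le> (\<Sum>k<r. K * sqrt (\<Sum>s<n. (cmod (x s))\<^sup>2) * sqrt (\<Sum>s<n. (cmod (y s))\<^sup>2))"
    by (rule sum_norm_le) (use assms in \<open>auto simp: bilinear_bound_def\<close>)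
  finally show "cmod (\<Sum>s<n. \<Sum>t<n. (\<Sum>k<r. M k s t) * x s * y t)
        \<le> r * K * sqrt (\<Sum>s<n. (cmod (x s))\<^sup>2) * sqrt (\<Sum>s<n. (cmod (y s))\<^sup>2)"
    by (simp add: algebra_simps)
qed

lemma sum_rotate3:
  "(\<Sum>s\<in>A. \<Sum>t\<in>B. \<Sum>i\<in>C. g s t i) = (\<Sum>i\<in>C. \<Sum>s\<in>A. \<Sum>t\<in>B. g s t i)"
  by (rule trans[OF sum.cong[OF refl sum.swap] sum.swap])

lemma sum_swap_pairs:
  "(\<Sum>s\<in>A. \<Sum>t\<in>B. \<Sum>i\<in>C. \<Sum>j\<in>D. g s t i j) = (\<Sum>i\<in>C. \<Sum>j\<in>D. \<Sum>s\<in>A. \<Sum>t\<in>B. g s t i j)"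
  by (rule trans[OF sum_rotate3 sum.cong[OF refl sum_rotate3]])

text \<open>With P = sum_i p_i u_i u_i^* and Q = sum_j q_j v_j v_j^*, the array is the transpose of
  Q P, and each of the two factors has operator norm at most C.\<close>

lemma bilinear_bound_sandwich:
  assumes u: "unitary_array n u" and v: "unitary_array n v"
    and p: "\<And>i. i < n \<Longrightarrow> cmod (p i) \<le> C" and q: "\<And>i. i < n \<Longrightarrow> cmod (q i) \<le> C" and C: "0 \<le> C"
  shows "bilinear_bound n (C\<^sup>2) (\<lambda>s t. \<Sum>i<n. \<Sum>j<n.
           p i * q j * (\<Sum>r<n. u i r * cnj (v j r)) * cnj (u i s) * v j t)"
  unfolding bilinear_bound_def
proof (intro allI)
  fix x y :: "nat \<Rightarrow> complex"
  define X where "X i = p i * (\<Sum>s<n. cnj (u i s) * x s)" for i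
  define Y where "Y j = q j * (\<Sum>t<n. v j t * y t)" for j
  define S where "S i j = (\<Sum>r<n. u i r * cnj (v j r))" for i j
  have "(\<Sum>s<n. \<Sum>t<n. (\<Sum>i<n. \<Sum>j<n. p i * q j * S i j * cnj (u i s) * v j t) * x s * y t)
     = (\<Sum>s<n. \<Sum>t<n. \<Sum>i<n. \<Sum>j<n. S i j * (p i * (cnj (u i s) * x s)) * (q j * (v j t * y t)))"
    unfolding sum_distrib_right by (simp only: mult_ac)
  also have "\<dots> = (\<Sum>i<n. \<Sum>j<n. \<Sum>s<n. \<Sum>t<n. S i j * (p i * (cnj (u i s) * x s)) * (q j * (v j t * y t)))"
    by (rule sum_swap_pairs)
  also have "\<dots> = (\<Sum>i<n. \<Sum>j<n. S i j * X i * Y j)"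
    by (simp only: X_def Y_def sum_distrib_left[symmetric] sum_distrib_right[symmetric])
  \<comment> \<open>Writing the overlap \<open>S i j\<close> again as a sum over coordinates r
    separates the \<open>X\<close> part from the \<open>Y\<close> part, so that Cauchy-Schwarz in r
    applies and Parseval removes both bases.\<close>
  also have "\<dots> = (\<Sum>i<n. \<Sum>j<n. \<Sum>r<n. (u i r * X i) * (cnj (v j r) * Y j))"
    unfolding S_def sum_distrib_right by (simp only: mult_ac)
  also have "\<dots> = (\<Sum>r<n. \<Sum>i<n. \<Sum>j<n. (u i r * X i) * (cnj (v j r) * Y j))"
    by (rule sum_rotate3)
  also have "\<dots> = (\<Sum>r<n. (\<Sum>i<n. u i r * X i) * (\<Sum>j<n. cnj (v j r) * Y j))"
    by (simp add: sum_product)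
  also have "cmod \<dots> \<le> sqrt (\<Sum>r<n. (cmod (\<Sum>i<n. u i r * X i))\<^sup>2) * sqrt (\<Sum>r<n. (cmod (\<Sum>j<n. cnj (v j r) * Y j))\<^sup>2)"
    by (rule cauchy_schwarz_cmod)
  also have "\<dots> = sqrt (\<Sum>i<n. (cmod (X i))\<^sup>2) * sqrt (\<Sum>j<n. (cmod (Y j))\<^sup>2)"
    using unitary_array_parseval[OF u] unitary_array_parseval[OF unitary_array_cnj[OF v]] by simp
  also have "\<dots> \<le> (C * sqrt (\<Sum>s<n. (cmod (x s))\<^sup>2)) * (C * sqrt (\<Sum>s<n. (cmod (y s))\<^sup>2))"
  proof (intro mult_mono)
    have "(\<Sum>i<n. (cmod (X i))\<^sup>2) \<le> (\<Sum>i<n. C\<^sup>2 * (cmod (\<Sum>s<n. cnj (u i s) * x s))\<^sup>2)"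
      using p by (intro sum_mono) (auto simp: X_def norm_mult power_mult_distrib intro!: mult_right_mono power_mono)
    also have "\<dots> = C\<^sup>2 * (\<Sum>s<n. (cmod (x s))\<^sup>2)"
      using unitary_array_parseval[OF unitary_array_swap[OF unitary_array_cnj[OF u]]]
      by (simp flip: sum_distrib_left)
    finally show "sqrt (\<Sum>i<n. (cmod (X i))\<^sup>2) \<le> C * sqrt (\<Sum>s<n. (cmod (x s))\<^sup>2)"
      using C by (metis real_sqrt_le_iff real_sqrt_mult real_sqrt_unique)
    have "(\<Sum>i<n. (cmod (Y i))\<^sup>2) \<le> (\<Sum>i<n. C\<^sup>2 * (cmod (\<Sum>s<n. v i s * y s))\<^sup>2)"
      using q by (intro sum_mono) (auto simp: Y_def norm_mult power_mult_distrib intro!: mult_right_mono power_mono)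
    also have "\<dots> = C\<^sup>2 * (\<Sum>s<n. (cmod (y s))\<^sup>2)"
      using unitary_array_parseval[OF unitary_array_swap[OF v]]
      by (simp flip: sum_distrib_left)
    finally show "sqrt (\<Sum>i<n. (cmod (Y i))\<^sup>2) \<le> C * sqrt (\<Sum>s<n. (cmod (y s))\<^sup>2)"
      using C by (metis real_sqrt_le_iff real_sqrt_mult real_sqrt_unique)
  qed (use C in \<open>auto intro!: mult_nonneg_nonneg sum_nonneg\<close>)
  finally show "cmod (\<Sum>s<n. \<Sum>t<n. (\<Sum>i<n. \<Sum>j<n.
           p i * q j * (\<Sum>r<n. u i r * cnj (v j r)) * cnj (u i s) * v j t) * x s * y t)
        \<le> C\<^sup>2 * sqrt (\<Sum>s<n. (cmod (x s))\<^sup>2) * sqrt (\<Sum>s<n. (cmod (y s))\<^sup>2)"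
    by (simp add: S_def power2_eq_square mult_ac)
qed

text \<open>The divided difference of \<open>F\<close> is a sum of \<open>r\<close> products of bounded functions of one variable.
  This makes \<open>A \<mapsto> tr F(A)\<close> Lipschitz for the trace norm on Hermitian matrices without any
  eigenvalue inequality: expand the difference of the traces in the two eigenbases.\<close>

definition separable :: "nat \<Rightarrow> real \<Rightarrow> (real \<Rightarrow> complex) \<Rightarrow> bool" where
  "separable r C F \<longleftrightarrow> (\<exists>p q. (\<forall>k x. cmod (p k x) \<le> C \<and> cmod (q k x) \<le> C) \<and>
     (\<forall>x y. F x - F y = complex_of_real (x - y) * (\<Sum>k<r. p k x * q k y)))"

text \<open>Here \<open>M\<close> is the transpose of sum_k q_k(b) p_k(a), so the identity reads tr
  F(a) - tr F(b) = tr (sum_k q_k(b) p_k(a) (a - b)).\<close>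

lemma separable_eigenvalue_sums:
  assumes F: "separable r C F"
    and u: "eigenbasis n a u l" and v: "eigenbasis n b v m"
    and herm: "\<And>s t. s < n \<Longrightarrow> t < n \<Longrightarrow> a t s = cnj (a s t)"
  obtains M where "bilinear_bound n (r * C\<^sup>2) M"
    "(\<Sum>i<n. F (l i)) - (\<Sum>i<n. F (m i)) = (\<Sum>s<n. \<Sum>t<n. M s t * (a s t - b s t))"
proof -
  obtain p q where pq: "\<And>k x. cmod (p k x) \<le> C" "\<And>k x. cmod (q k x) \<le> C"
    and F_diff: "\<And>x y. F x - F y = complex_of_real (x - y) * (\<Sum>k<r. p k x * q k y)"
    using F unfolding separable_def by blast
  have C: "0 \<le> C" using pq(1)[of 0 0] norm_ge_zero order_trans by blast
  have U: "unitary_array n u" and V: "unitary_array n v" using u v by (auto simp: eigenbasis_def)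
  define S where "S i j = (\<Sum>s<n. u i s * cnj (v j s))" for i j
  define S' where "S' i j = (\<Sum>s<n. cnj (u i s) * v j s)" for i j
  have S': "S' i j = cnj (S i j)" for i j by (simp add: S_def S'_def)
  \<comment> \<open>The squared overlaps of the two bases form a doubly stochastic array. Weighting
    with it turns both single sums of \<open>F\<close> into double sums over the same pairs (i, j),
    where the differences F(l i) - F(m j) can be formed.\<close>
  have Si: "(\<Sum>j<n. S i j * S' i j) = 1" if "i < n" for i
  proof -
    have "(\<Sum>j<n. (cmod (\<Sum>s<n. cnj (v j s) * u i s))\<^sup>2) = (\<Sum>s<n. (cmod (u i s))\<^sup>2)"
      by (rule unitary_array_parseval[OF unitary_array_swap[OF unitary_array_cnj[OF V]]])
    then have "(\<Sum>j<n. (cmod (S i j))\<^sup>2) = (\<Sum>s<n. (cmod (u i s))\<^sup>2)"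
      by (simp add: S_def mult.commute)
    then have "(\<Sum>j<n. S i j * S' i j) = (\<Sum>s<n. u i s * cnj (u i s))"
      unfolding S' complex_norm_square[symmetric] by (simp flip: of_real_sum of_real_power)
    then show ?thesis using U that by (simp add: unitary_array_def)
  qed
  have Sj: "(\<Sum>i<n. S i j * S' i j) = 1" if "j < n" for j
  proof -
    have "(\<Sum>i<n. (cmod (\<Sum>s<n. u i s * cnj (v j s)))\<^sup>2) = (\<Sum>s<n. (cmod (cnj (v j s)))\<^sup>2)"
      by (rule unitary_array_parseval[OF unitary_array_swap[OF U]])
    then have "(\<Sum>i<n. (cmod (S i j))\<^sup>2) = (\<Sum>s<n. (cmod (v j s))\<^sup>2)"
      by (simp add: S_def)
    then have "(\<Sum>i<n. S i j * S' i j) = (\<Sum>s<n. v j s * cnj (v j s))"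
      unfolding S' complex_norm_square[symmetric] by (simp flip: of_real_sum of_real_power)
    then show ?thesis using V that by (simp add: unitary_array_def)
  qed
  define N where "N k s t = (\<Sum>i<n. \<Sum>j<n. p k (l i) * q k (m j) * S i j * cnj (u i s) * v j t)" for k s t
  have N: "bilinear_bound n (C\<^sup>2) (N k)" for k
    unfolding N_def S_def by (rule bilinear_bound_sandwich[OF U V]) (use pq C in auto)
  have "(\<Sum>i<n. F (l i)) - (\<Sum>j<n. F (m j))
      = (\<Sum>i<n. \<Sum>j<n. S i j * S' i j * F (l i)) - (\<Sum>j<n. \<Sum>i<n. S i j * S' i j * F (m j))"
    using Si Sj by (simp flip: sum_distrib_right)
  also have "\<dots> = (\<Sum>i<n. \<Sum>j<n. S i j * S' i j * (F (l i) - F (m j)))"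
    by (subst (2) sum.swap) (simp add: right_diff_distrib sum_subtractf)
  also have "\<dots> = (\<Sum>i<n. \<Sum>j<n. S i j * (\<Sum>k<r. p k (l i) * q k (m j)) * ((l i - m j) * S' i j))"
    by (simp add: F_diff mult_ac)
  also have "\<dots> = (\<Sum>i<n. \<Sum>j<n. S i j * (\<Sum>k<r. p k (l i) * q k (m j)) *
      (\<Sum>s<n. \<Sum>t<n. cnj (u i s) * (a s t - b s t) * v j t))"
    unfolding S'_def by (intro sum.cong refl) (use eigenbasis_cross[OF u v herm] in auto)
  also have "\<dots> = (\<Sum>i<n. \<Sum>j<n. \<Sum>s<n. \<Sum>t<n.
      (\<Sum>k<r. p k (l i) * q k (m j) * S i j * cnj (u i s) * v j t) * (a s t - b s t))"
    unfolding sum_distrib_left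
    by (intro sum.cong refl) (simp add: sum_distrib_left sum_distrib_right mult_ac)
  also have "\<dots> = (\<Sum>s<n. \<Sum>t<n. \<Sum>i<n. \<Sum>j<n.
      (\<Sum>k<r. p k (l i) * q k (m j) * S i j * cnj (u i s) * v j t) * (a s t - b s t))"
    by (rule sum_swap_pairs)
  also have "\<dots> = (\<Sum>s<n. \<Sum>t<n. (\<Sum>k<r. N k s t) * (a s t - b s t))"
  proof (intro sum.cong refl)
    fix s t
    have "(\<Sum>k<r. N k s t) = (\<Sum>i<n. \<Sum>k<r. \<Sum>j<n. p k (l i) * q k (m j) * S i j * cnj (u i s) * v j t)"
      unfolding N_def by (rule sum.swap)
    also have "\<dots> = (\<Sum>i<n. \<Sum>j<n. \<Sum>k<r. p k (l i) * q k (m j) * S i j * cnj (u i s) * v j t)"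
      by (intro sum.cong refl sum.swap)
    finally show "(\<Sum>i<n. \<Sum>j<n. (\<Sum>k<r. p k (l i) * q k (m j) * S i j * cnj (u i s) * v j t) * (a s t - b s t))
       = (\<Sum>k<r. N k s t) * (a s t - b s t)"
      by (simp flip: sum_distrib_right)
  qed
  finally show ?thesis
    using that bilinear_bound_sum[of r n "C\<^sup>2" N] N by blast
qed

subsection \<open>Hankel forms of integrable symbols\<close>

definition circ :: "real measure" where
  "circ = lebesgue_on {-pi..pi}"

lemma space_circ [simp]: "space circ = {-pi..pi}"
  by (simp add: circ_def)

lemma finite_measure_circ: "finite_measure circ"
  unfolding circ_def by (rule finite_measure_lebesgue_on) (simp add: lmeasurable_cbox[of "-pi" pi, simplified])

lemma measure_circ: "measure circ {-pi..pi} = 2 * pi"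
  unfolding circ_def by (simp add: measure_restrict_space)

interpretation circ: finite_measure circ
  by (rule finite_measure_circ)

lemma integrable_circ_iff:
  fixes f :: "real \<Rightarrow> complex"
  shows "integrable circ f \<longleftrightarrow> set_integrable lebesgue {-pi..pi} f"
  by (simp add: circ_def set_integrable_def integrable_restrict_space)

lemma fourier_coeff_circ:
  "fourier_coeff f k = (LINT \<theta>|circ. f \<theta> * exp (- (\<i> * of_int k * complex_of_real \<theta>))) / (2 * pi)"
  by (simp add: fourier_coeff_def circ_def set_lebesgue_integral_def integral_restrict_space)

lemma continuous_borel_measurable_circ:
  fixes g :: "real \<Rightarrow> complex"
  assumes "continuous_on {-pi..pi} g"
  shows "g \<in> borel_measurable circ"
  unfolding circ_def by (rule continuous_imp_measurable_on_sets_lebesgue[OF assms]) simp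

lemma integrable_circ_mult_bounded:
  fixes f g :: "real \<Rightarrow> complex"
  assumes f: "integrable circ f" and g: "g \<in> borel_measurable circ" and le: "\<And>\<theta>. \<theta> \<in> {-pi..pi} \<Longrightarrow> cmod (g \<theta>) \<le> B"
  shows "integrable circ (\<lambda>\<theta>. f \<theta> * g \<theta>)"
proof (rule Bochner_Integration.integrable_bound)
  show "integrable circ (\<lambda>\<theta>. of_real B * f \<theta>)" using f by simp
  show "(\<lambda>\<theta>. f \<theta> * g \<theta>) \<in> borel_measurable circ" using f g by auto
  have "cmod (f \<theta>) * cmod (g \<theta>) \<le> \<bar>B\<bar> * cmod (f \<theta>)" if "\<theta> \<in> {-pi..pi}" for \<theta>
    using mult_right_mono[OF order_trans[OF le[OF that] abs_ge_self], of "cmod (f \<theta>)"] by (simp add: mult.commute)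
  then show "AE \<theta> in circ. norm (f \<theta> * g \<theta>) \<le> norm (of_real B * f \<theta>)"
    by (intro AE_I2) (auto simp: norm_mult)
qed

lemma integrable_circ_mult_exp:
  assumes "integrable circ f"
  shows "integrable circ (\<lambda>\<theta>. f \<theta> * exp (- (\<i> * of_int k * complex_of_real \<theta>)))"
  by (rule integrable_circ_mult_bounded[OF assms continuous_borel_measurable_circ, of _ 1])
    (auto intro!: continuous_intros)

lemma fourier_coeff_diff:
  assumes "integrable circ f" "integrable circ g"
  shows "fourier_coeff (\<lambda>\<theta>. f \<theta> - g \<theta>) k = fourier_coeff f k - fourier_coeff g k"
  using assms by (simp add: fourier_coeff_circ left_diff_distrib diff_divide_distrib integrable_circ_mult_exp)

text \<open>Counted from 0, row s of the flipped matrix is row n - 1 - s of the Toeplitz matrix,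
  which explains the index.\<close>

definition hankel_coeff :: "(real \<Rightarrow> complex) \<Rightarrow> nat \<Rightarrow> nat \<Rightarrow> nat \<Rightarrow> complex" where
  "hankel_coeff f n s t = fourier_coeff f (int n - 1 - int s - int t)"

lemma flip_mult_toeplitz:
  "flip_mat n * toeplitz_mat n f = Matrix.mat n n (\<lambda>(s, t). hankel_coeff f n s t)"
proof (rule eq_matI)
  fix s t assume "s < dim_row (Matrix.mat n n (\<lambda>(s, t). hankel_coeff f n s t))"
    "t < dim_col (Matrix.mat n n (\<lambda>(s, t). hankel_coeff f n s t))"
  then have st: "s < n" "t < n" by auto
  have "(flip_mat n * toeplitz_mat n f) $$ (s, t) =
      (\<Sum>k<n. (if Suc s + Suc k = n + 1 then 1 else 0) * fourier_coeff f (int (Suc k) - int (Suc t)))"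
    using st by (simp add: flip_mat_def toeplitz_mat_def scalar_prod_def lessThan_atLeast0)
  also have "\<dots> = (\<Sum>k<n. if k = n - 1 - s then fourier_coeff f (int (Suc k) - int (Suc t)) else 0)"
    using st by (intro sum.cong) auto
  also have "\<dots> = fourier_coeff f (int (Suc (n - 1 - s)) - int (Suc t))"
    using st by (simp add: sum.delta)
  also have "int (Suc (n - 1 - s)) - int (Suc t) = int n - 1 - int s - int t"
    using st by (simp add: of_nat_diff)
  finally show "(flip_mat n * toeplitz_mat n f) $$ (s, t) =
      Matrix.mat n n (\<lambda>(s, t). hankel_coeff f n s t) $$ (s, t)"
    using st by (simp add: hankel_coeff_def)
qed (auto simp: flip_mat_def toeplitz_mat_def)

text \<open>The entry depends on s + t only, so the array is symmetric; real coefficients make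
  symmetric the same as Hermitian.\<close>

lemma hankel_coeff_hermitian:
  assumes "\<And>k. fourier_coeff f k \<in> \<real>"
  shows "hankel_coeff f n t s = cnj (hankel_coeff f n s t)"
  using assms[of "int n - 1 - int s - int t"] Reals_cnj_iff
  by (auto simp: hankel_coeff_def algebra_simps)

text \<open>The matrix of the bilinear form is the average of \<open>g(\<theta>)\<close> times a rank-one matrix
  of norm \<open>n\<close>, which is why it has trace norm at most \<open>n \<parallel>g\<parallel>\<^sub>1 / 2\<pi>\<close>.\<close>

lemma hankel_trace_norm:
  assumes g: "integrable circ g" and M: "bilinear_bound n K M"
  shows "cmod (\<Sum>s<n. \<Sum>t<n. M s t * hankel_coeff g n s t) \<le> K * n * (LINT \<theta>|circ. cmod (g \<theta>)) / (2 * pi)"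
proof -
  define e where "e k \<theta> = exp (- (\<i> * of_int k * complex_of_real \<theta>))" for k :: int and \<theta> :: real
  have norm_e: "cmod (e k \<theta>) = 1" for k \<theta> by (simp add: e_def)
  have e_add: "e (int n - 1 - int s - int t) \<theta> = e (int n - 1 - int s) \<theta> * e (- int t) \<theta>" for s t \<theta>
    by (simp add: e_def algebra_simps flip: exp_add)
  define Q where "Q \<theta> = (\<Sum>s<n. \<Sum>t<n. M s t * e (int n - 1 - int s) \<theta> * e (- int t) \<theta>)" for \<theta>
  \<comment> \<open>Both vectors put into the form have unimodular entries, so each has norm sqrt
    n.\<close>
  have Q_le: "cmod (Q \<theta>) \<le> K * n" for \<theta>
    using M[unfolded bilinear_bound_def, rule_format, of "\<lambda>s. e (int n - 1 - int s) \<theta>" "\<lambda>t. e (- int t) \<theta>"]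
    by (simp add: Q_def norm_e mult.assoc)
  have Q_cont: "continuous_on {-pi..pi} Q"
    unfolding Q_def e_def by (intro continuous_intros)
  have int_e: "integrable circ (\<lambda>\<theta>. g \<theta> * e k \<theta>)" for k
    unfolding e_def by (rule integrable_circ_mult_exp[OF g])
  have "(\<Sum>s<n. \<Sum>t<n. M s t * hankel_coeff g n s t)
      = (\<Sum>s<n. \<Sum>t<n. LINT \<theta>|circ. M s t * (g \<theta> * e (int n - 1 - int s - int t) \<theta>)) / (2 * pi)"
    by (simp add: hankel_coeff_def fourier_coeff_circ e_def sum_divide_distrib)
  also have "(\<Sum>s<n. \<Sum>t<n. LINT \<theta>|circ. M s t * (g \<theta> * e (int n - 1 - int s - int t) \<theta>))
      = (LINT \<theta>|circ. (\<Sum>s<n. \<Sum>t<n. M s t * (g \<theta> * e (int n - 1 - int s - int t) \<theta>)))"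
    by (simp add: Bochner_Integration.integral_sum int_e)
  also have "\<dots> = (LINT \<theta>|circ. g \<theta> * Q \<theta>)"
    unfolding Q_def by (simp add: e_add sum_distrib_left mult_ac)
  also have "cmod ((LINT \<theta>|circ. g \<theta> * Q \<theta>) / (2 * pi)) = cmod (LINT \<theta>|circ. g \<theta> * Q \<theta>) / (2 * pi)"
    by (simp add: norm_divide)
  also have "cmod (LINT \<theta>|circ. g \<theta> * Q \<theta>) \<le> (LINT \<theta>|circ. cmod (g \<theta> * Q \<theta>))"
    by (rule integral_norm_bound)
  also have "\<dots> \<le> (LINT \<theta>|circ. K * n * cmod (g \<theta>))"
  proof (rule integral_mono)
    show "integrable circ (\<lambda>\<theta>. cmod (g \<theta> * Q \<theta>))"
      by (intro integrable_norm integrable_circ_mult_bounded[OF g continuous_borel_measurable_circ[OF Q_cont] Q_le])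
    show "cmod (g \<theta> * Q \<theta>) \<le> K * n * cmod (g \<theta>)" for \<theta>
      using mult_left_mono[OF Q_le, of "cmod (g \<theta>)"] by (simp add: norm_mult mult_ac)
  qed (use g in simp)
  finally show ?thesis by (simp add: divide_right_mono)
qed

text \<open>\<open>Re\<close> allows test functions on the real line; for real Fourier coefficients
  the eigenvalues are real and nothing is lost. For n = 0 the quotient is 0.\<close>

definition ev_mean :: "(real \<Rightarrow> complex) \<Rightarrow> nat \<Rightarrow> (real \<Rightarrow> complex) \<Rightarrow> complex" where
  "ev_mean f n F = (\<Sum>z\<in>#eigenvalues_mset (flip_mat n * toeplitz_mat n f). F (Re z)) / n"

text \<open>The integral of \<open>F\<close> over the symbol on the domain of length \<open>4\<pi>\<close>, folded onto one period.\<close>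

definition limit_mean :: "(real \<Rightarrow> complex) \<Rightarrow> (real \<Rightarrow> complex) \<Rightarrow> complex" where
  "limit_mean f F = (LINT \<theta>|circ. F (cmod (f \<theta>)) + F (- cmod (f \<theta>))) / (4 * pi)"

lemma ev_mean_eigenbasis:
  assumes "\<And>k. fourier_coeff f k \<in> \<real>"
  obtains u l where "eigenbasis n (hankel_coeff f n) u l"
    "\<And>F :: complex \<Rightarrow> complex. (\<Sum>z\<in>#eigenvalues_mset (flip_mat n * toeplitz_mat n f). F z) = (\<Sum>i<n. F (l i))"
    "\<And>F. ev_mean f n F = (\<Sum>i<n. F (l i)) / n"
proof -
  obtain u l where "eigenbasis n (hankel_coeff f n) u l"
    and ev: "eigenvalues_mset (Matrix.mat n n (\<lambda>(s, t). hankel_coeff f n s t)) =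
      image_mset (\<lambda>i. complex_of_real (l i)) (mset_set {..<n})"
    using hermitian_eigenbasis[of n "hankel_coeff f n"] hankel_coeff_hermitian[OF assms] by blast
  moreover have "(\<Sum>z\<in>#eigenvalues_mset (flip_mat n * toeplitz_mat n f). F z) = (\<Sum>i<n. F (l i))"
    for F :: "complex \<Rightarrow> complex"
    by (simp add: flip_mult_toeplitz ev multiset.map_comp comp_def sum_unfold_sum_mset)
  ultimately show ?thesis using that unfolding ev_mean_def by simp
qed

text \<open>The factor n of \<open>hankel_trace_norm\<close> cancels against the average over n
  eigenvalues, which leaves a bound uniform in n.\<close>

lemma ev_mean_perturbation:
  assumes F: "separable r C F" and f: "integrable circ f" and g: "integrable circ g"
    and f_real: "\<And>k. fourier_coeff f k \<in> \<real>" and g_real: "\<And>k. fourier_coeff g k \<in> \<real>"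
  shows "cmod (ev_mean f n F - ev_mean g n F) \<le> r * C\<^sup>2 * (LINT \<theta>|circ. cmod (f \<theta> - g \<theta>)) / (2 * pi)"
proof -
  obtain u l where u: "eigenbasis n (hankel_coeff f n) u l" and l: "\<And>F. ev_mean f n F = (\<Sum>i<n. F (l i)) / n"
    by (rule ev_mean_eigenbasis[OF f_real, of n]) (rule that)
  obtain v m where v: "eigenbasis n (hankel_coeff g n) v m" and m: "\<And>F. ev_mean g n F = (\<Sum>i<n. F (m i)) / n"
    by (rule ev_mean_eigenbasis[OF g_real, of n]) (rule that)
  obtain M where M: "bilinear_bound n (r * C\<^sup>2) M"
    and diff: "(\<Sum>i<n. F (l i)) - (\<Sum>i<n. F (m i)) =
      (\<Sum>s<n. \<Sum>t<n. M s t * (hankel_coeff f n s t - hankel_coeff g n s t))"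
    by (rule separable_eigenvalue_sums[OF F u v hankel_coeff_hermitian[OF f_real]]) (rule that)
  have le: "cmod ((\<Sum>i<n. F (l i)) - (\<Sum>i<n. F (m i))) \<le> r * C\<^sup>2 * n * (LINT \<theta>|circ. cmod (f \<theta> - g \<theta>)) / (2 * pi)"
    using hankel_trace_norm[OF Bochner_Integration.integrable_diff[OF f g] M]
    by (simp add: diff hankel_coeff_def fourier_coeff_diff[OF f g])
  have "ev_mean f n F - ev_mean g n F = ((\<Sum>i<n. F (l i)) - (\<Sum>i<n. F (m i))) / n"
    by (simp add: l m diff_divide_distrib)
  then have "cmod (ev_mean f n F - ev_mean g n F) = cmod ((\<Sum>i<n. F (l i)) - (\<Sum>i<n. F (m i))) / n"
    by (simp only: norm_divide norm_of_nat)
  also have "\<dots> \<le> r * C\<^sup>2 * n * (LINT \<theta>|circ. cmod (f \<theta> - g \<theta>)) / (2 * pi) / n"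
    by (rule divide_right_mono[OF le]) simp
  also have "\<dots> \<le> r * C\<^sup>2 * (LINT \<theta>|circ. cmod (f \<theta> - g \<theta>)) / (2 * pi)"
    by (cases "n = 0") (auto intro!: divide_nonneg_nonneg mult_nonneg_nonneg)
  finally show ?thesis .
qed

lemma separable_lipschitz:
  assumes "separable r C F"
  shows "cmod (F x - F y) \<le> r * C\<^sup>2 * \<bar>x - y\<bar>"
proof -
  obtain p q where pq: "\<And>k x. cmod (p k x) \<le> C" "\<And>k x. cmod (q k x) \<le> C"
    and F_diff: "\<And>x y. F x - F y = complex_of_real (x - y) * (\<Sum>k<r. p k x * q k y)"
    using assms unfolding separable_def by blast
  have C: "0 \<le> C" using pq(1)[of 0 0] norm_ge_zero order_trans by blast
  have "cmod (\<Sum>k<r. p k x * q k y) \<le> (\<Sum>k<r. C * C)"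
    by (rule sum_norm_le) (use pq C in \<open>auto simp: norm_mult intro!: mult_mono\<close>)
  then have "cmod (\<Sum>k<r. p k x * q k y) \<le> r * C\<^sup>2" by (simp add: power2_eq_square)
  then show ?thesis unfolding F_diff norm_mult
    by (simp add: mult.commute mult_left_mono del: of_real_diff)
qed

lemma separable_continuous:
  assumes "separable r C F"
  shows "continuous_on UNIV F"
proof -
  have "(r * C\<^sup>2)-lipschitz_on UNIV F"
    using separable_lipschitz[OF assms] by (auto intro!: lipschitz_onI simp: dist_norm)
  then show ?thesis by (rule lipschitz_on_continuous_on)
qed

lemma separable_integrable:
  assumes F: "separable r C F" and h: "integrable circ h"
  shows "integrable circ (\<lambda>\<theta>. F (h \<theta>))"
proof (rule Bochner_Integration.integrable_bound)
  show "integrable circ (\<lambda>\<theta>. cmod (F 0) + r * C\<^sup>2 * \<bar>h \<theta>\<bar>)" using h by simp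
  show "(\<lambda>\<theta>. F (h \<theta>)) \<in> borel_measurable circ"
    using borel_measurable_continuous_onI[OF separable_continuous[OF F]] h by measurable
  have "cmod (F x) \<le> \<bar>cmod (F 0) + r * C\<^sup>2 * \<bar>x\<bar>\<bar>" for x
    using separable_lipschitz[OF F, of x 0] norm_triangle_sub[of "F x" "F 0"] by simp
  then show "AE \<theta> in circ. norm (F (h \<theta>)) \<le> norm (cmod (F 0) + r * C\<^sup>2 * \<bar>h \<theta>\<bar>)" by simp
qed

text \<open>The same bound as for \<open>ev_mean\<close>: each sign contributes one Lipschitz term,
  and 2 / (4 pi) = 1 / (2 pi). Replacing f by |f| costs nothing by the reverse triangle
  inequality.\<close>

lemma limit_mean_perturbation:
  assumes F: "separable r C F" and f: "integrable circ f" and g: "integrable circ g"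
  shows "cmod (limit_mean f F - limit_mean g F) \<le> r * C\<^sup>2 * (LINT \<theta>|circ. cmod (f \<theta> - g \<theta>)) / (2 * pi)"
proof -
  define H where "H h \<theta> = F (cmod (h \<theta>)) + F (- cmod (h \<theta>))" for h :: "real \<Rightarrow> complex" and \<theta>
  have H: "integrable circ (H h)" if "integrable circ h" for h
    unfolding H_def using that separable_integrable[OF F] by simp
  have le: "cmod (H f \<theta> - H g \<theta>) \<le> 2 * r * C\<^sup>2 * cmod (f \<theta> - g \<theta>)" for \<theta>
  proof -
    let ?d = "\<bar>cmod (f \<theta>) - cmod (g \<theta>)\<bar>"
    have "cmod (H f \<theta> - H g \<theta>) \<le> cmod (F (cmod (f \<theta>)) - F (cmod (g \<theta>))) + cmod (F (- cmod (f \<theta>)) - F (- cmod (g \<theta>)))"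
      unfolding H_def by (simp add: norm_diff_triangle_ineq)
    also have "\<dots> \<le> r * C\<^sup>2 * ?d + r * C\<^sup>2 * ?d"
      using separable_lipschitz[OF F, of "cmod (f \<theta>)" "cmod (g \<theta>)"]
        separable_lipschitz[OF F, of "- cmod (f \<theta>)" "- cmod (g \<theta>)"] by (simp add: abs_minus_commute)
    also have "\<dots> = 2 * r * C\<^sup>2 * ?d" by simp
    also have "\<dots> \<le> 2 * r * C\<^sup>2 * cmod (f \<theta> - g \<theta>)"
      by (intro mult_left_mono norm_triangle_ineq3) auto
    finally show ?thesis .
  qed
  have "limit_mean f F - limit_mean g F = (LINT \<theta>|circ. H f \<theta> - H g \<theta>) / (4 * pi)"
    using H[OF f] H[OF g] by (simp add: limit_mean_def diff_divide_distrib flip: H_def)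
  then have "cmod (limit_mean f F - limit_mean g F) = cmod (LINT \<theta>|circ. H f \<theta> - H g \<theta>) / (4 * pi)"
    by (simp add: norm_divide)
  also have "cmod (LINT \<theta>|circ. H f \<theta> - H g \<theta>) \<le> (LINT \<theta>|circ. cmod (H f \<theta> - H g \<theta>))"
    by (rule integral_norm_bound)
  also have "\<dots> \<le> (LINT \<theta>|circ. 2 * r * C\<^sup>2 * cmod (f \<theta> - g \<theta>))"
    using H f g le by (intro integral_mono) auto
  finally show ?thesis by (simp add: divide_right_mono)
qed

subsection \<open>Density of the resolvent algebra\<close>

text \<open>Boundedness is carried along because the product rule multiplies the divided difference
  of one factor by values of the other.\<close>

definition bounded_separable :: "(real \<Rightarrow> complex) \<Rightarrow> bool" where
  "bounded_separable F \<longleftrightarrow> (\<exists>r C. separable r C F) \<and> (\<exists>B. \<forall>x. cmod (F x) \<le> B)"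

lemma separable_const: "separable 0 0 (\<lambda>x. c)"
  unfolding separable_def by (intro exI[of _ "\<lambda>_ _. 0"]) auto

lemma sum_lessThan_add:
  fixes h :: "nat \<Rightarrow> 'a::comm_monoid_add"
  shows "(\<Sum>k<m + n. h k) = (\<Sum>k<m. h k) + (\<Sum>k<n. h (m + k))"
  by (induction n) (auto simp: add.assoc)

text \<open>The weight a(x) can be absorbed into the x-factors of \<open>G\<close> and b(y) into the
  y-factors of \<open>F\<close>. Constant weights 1 give sums; the weights F and G give products
  through the Leibniz rule F(x) (G(x) - G(y)) + (F(x) - F(y)) G(y).\<close>

lemma separable_add_weighted:
  assumes F: "separable r C F" and G: "separable r' C' G"
    and a: "\<And>x. cmod (a x) \<le> A" and b: "\<And>x. cmod (b x) \<le> A" and A: "1 \<le> A"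
    and H: "\<And>x y. H x - H y = a x * (G x - G y) + (F x - F y) * b y"
  shows "\<exists>C. separable (r + r') C H"
proof -
  obtain p q where pq: "\<And>k x. cmod (p k x) \<le> C" "\<And>k x. cmod (q k x) \<le> C"
    and F_diff: "\<And>x y. F x - F y = complex_of_real (x - y) * (\<Sum>k<r. p k x * q k y)"
    using F unfolding separable_def by blast
  obtain p' q' where pq': "\<And>k x. cmod (p' k x) \<le> C'" "\<And>k x. cmod (q' k x) \<le> C'"
    and G_diff: "\<And>x y. G x - G y = complex_of_real (x - y) * (\<Sum>k<r'. p' k x * q' k y)"
    using G unfolding separable_def by blast
  have C: "0 \<le> C" "0 \<le> C'"
    using pq(1)[of 0 0] pq'(1)[of 0 0] norm_ge_zero order_trans by blast+
  define P where "P k x = (if k < r then p k x else a x * p' (k - r) x)" for k x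
  define Q where "Q k x = (if k < r then q k x * b x else q' (k - r) x)" for k x
  define D where "D = A * (C + C')"
  have D: "C \<le> D" "C' \<le> D" "A * C' \<le> D" "C * A \<le> D"
  proof -
    show "A * C' \<le> D" "C * A \<le> D" using A C by (auto simp: D_def distrib_left mult.commute)
    have "C \<le> A * C" "C' \<le> A * C'" using A C mult_right_mono[of 1 A] by auto
    then show "C \<le> D" "C' \<le> D" using C A by (auto simp: D_def distrib_left intro: order_trans)
  qed
  have "cmod (P k x) \<le> D" for k x
  proof (cases "k < r")
    case False
    have "cmod (a x) * cmod (p' (k - r) x) \<le> A * C'" using a pq' A C by (intro mult_mono) auto
    then show ?thesis using False D by (simp add: P_def norm_mult)
  qed (use order_trans[OF pq(1) D(1)] in \<open>simp add: P_def\<close>)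
  moreover have "cmod (Q k x) \<le> D" for k x
  proof (cases "k < r")
    case True
    have "cmod (q k x) * cmod (b x) \<le> C * A" using b pq A C by (intro mult_mono) auto
    then show ?thesis using True D by (simp add: Q_def norm_mult)
  qed (use order_trans[OF pq'(2) D(2)] in \<open>simp add: Q_def\<close>)
  moreover have "H x - H y = complex_of_real (x - y) * (\<Sum>k<r + r'. P k x * Q k y)" for x y
    unfolding H F_diff G_diff sum_lessThan_add P_def Q_def
    by (simp add: sum_distrib_left sum_distrib_right algebra_simps)
  ultimately show ?thesis unfolding separable_def by blast
qed

lemma bounded_separable_const: "bounded_separable (\<lambda>x. c)"
  unfolding bounded_separable_def using separable_const by blast

lemma bounded_separable_add:
  assumes "bounded_separable F" "bounded_separable G"
  shows "bounded_separable (\<lambda>x. F x + G x)"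
proof -
  obtain r C B r' C' B' where F: "separable r C F" "\<And>x. cmod (F x) \<le> B"
    and G: "separable r' C' G" "\<And>x. cmod (G x) \<le> B'"
    using assms unfolding bounded_separable_def by blast
  have "\<exists>C. separable (r + r') C (\<lambda>x. F x + G x)"
    by (rule separable_add_weighted[OF F(1) G(1), of "\<lambda>_. 1" 1 "\<lambda>_. 1"]) auto
  moreover have "cmod (F x + G x) \<le> B + B'" for x
    using F(2)[of x] G(2)[of x] norm_triangle_ineq[of "F x" "G x"] by linarith
  ultimately show ?thesis unfolding bounded_separable_def by blast
qed

lemma bounded_separable_mult:
  assumes "bounded_separable F" "bounded_separable G"
  shows "bounded_separable (\<lambda>x. F x * G x)"
proof -
  obtain r C B r' C' B' where F: "separable r C F" "\<And>x. cmod (F x) \<le> B"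
    and G: "separable r' C' G" "\<And>x. cmod (G x) \<le> B'"
    using assms unfolding bounded_separable_def by blast
  have B: "0 \<le> B" "0 \<le> B'" using F(2)[of 0] G(2)[of 0] norm_ge_zero order_trans by blast+
  have "\<exists>C. separable (r + r') C (\<lambda>x. F x * G x)"
  proof (rule separable_add_weighted[OF F(1) G(1), of F "1 + B + B'" G])
    show "cmod (F x) \<le> 1 + B + B'" "cmod (G x) \<le> 1 + B + B'" for x
      using F(2)[of x] G(2)[of x] B by auto
    show "F x * G x - F y * G y = F x * (G x - G y) + (F x - F y) * G y" for x y
      by (simp add: algebra_simps)
  qed (use B in auto)
  moreover have "cmod (F x * G x) \<le> B * B'" for x
    using F(2)[of x] G(2)[of x] B by (auto simp: norm_mult intro: mult_mono)
  ultimately show ?thesis unfolding bounded_separable_def by blast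
qed

text \<open>By the resolvent identity the divided difference is the single product -1/(x - z) * 1/(y
  - z), and |x - z| is at least |Im z| for real x.\<close>

lemma bounded_separable_resolvent:
  assumes z: "Im z \<noteq> 0"
  shows "bounded_separable (\<lambda>x. 1 / (complex_of_real x - z))"
proof -
  have nz: "complex_of_real x - z \<noteq> 0" for x using z by (auto simp: complex_eq_iff)
  have le: "cmod (1 / (complex_of_real x - z)) \<le> 1 / \<bar>Im z\<bar>" for x
    using z abs_Im_le_cmod[of "complex_of_real x - z"]
    by (simp add: norm_divide divide_simps)
  have "separable 1 (max 1 (1 / \<bar>Im z\<bar>)) (\<lambda>x. 1 / (complex_of_real x - z))"
    unfolding separable_def
  proof (rule exI[of _ "\<lambda>k x. - 1 / (complex_of_real x - z)"],
      rule exI[of _ "\<lambda>k x. 1 / (complex_of_real x - z)"], intro conjI allI)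
    fix x y
    show "1 / (complex_of_real x - z) - 1 / (complex_of_real y - z) = complex_of_real (x - y) *
        (\<Sum>k<1::nat. - 1 / (complex_of_real x - z) * (1 / (complex_of_real y - z)))"
      using nz[of x] nz[of y] by (simp add: divide_simps)
  qed (use le in \<open>auto simp: norm_divide intro: order_trans[OF _ max.cobounded2]\<close>)
  then show ?thesis unfolding bounded_separable_def using le by blast
qed

text \<open>Maps the real line to the unit circle without 1, with 1 standing for infinity; the
  compact circle makes Weierstrass available. Since it equals 1 - 2i/(x + i), it is affine in a
  resolvent.\<close>

definition cayley :: "real \<Rightarrow> complex" where
  "cayley x = (complex_of_real x - \<i>) / (complex_of_real x + \<i>)"

lemma real_plus_i_nonzero: "complex_of_real x + \<i> \<noteq> 0" "complex_of_real x - \<i> \<noteq> 0"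
  by (auto simp: complex_eq_iff)

lemma cayley_in_sphere: "cayley x \<in> sphere 0 1"
proof -
  have "cmod (complex_of_real x - \<i>) = cmod (complex_of_real x + \<i>)" by (simp add: cmod_def)
  then show ?thesis using real_plus_i_nonzero[of x] by (simp add: cayley_def norm_divide)
qed

lemma cayley_neq_1: "cayley x \<noteq> 1"
  using real_plus_i_nonzero[of x] by (simp add: cayley_def divide_eq_1_iff)

lemma cayley_inverse: "\<i> * (1 + cayley x) / (1 - cayley x) = x"
proof -
  have "1 + cayley x = 2 * x / (complex_of_real x + \<i>)" "1 - cayley x = 2 * \<i> / (complex_of_real x + \<i>)"
    using real_plus_i_nonzero[of x] by (auto simp: cayley_def divide_simps)
  then show ?thesis using real_plus_i_nonzero[of x] by simp
qed

lemma bounded_linear_complex_expand: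
  fixes h :: "complex \<Rightarrow> real"
  assumes "bounded_linear h"
  shows "h z = Re z * h 1 + Im z * h \<i>"
proof -
  interpret h: bounded_linear h by fact
  have "h z = h (Re z *\<^sub>R 1 + Im z *\<^sub>R \<i>)"
    by (rule arg_cong[where f = h]) (simp add: complex_eq_iff)
  then show ?thesis by (simp add: h.add h.scaleR)
qed

text \<open>Polynomials here are generated by real-linear functionals, which are combinations of w
  and cnj w. For w = \<open>cayley x\<close> these are 1 - 2i/(x + i) and 1 + 2i/(x - i); this is
  why both resolvents are needed.\<close>

lemma bounded_separable_polynomial_cayley:
  assumes "real_polynomial_function q"
  shows "bounded_separable (\<lambda>x. complex_of_real (q (cayley x)))"
  using assms
proof (induction q rule: real_polynomial_function.induct)
  case (linear h)
  note h_eq = bounded_linear_complex_expand[OF linear]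
  let ?r = "\<lambda>x. 1 / (complex_of_real x - (- \<i>))" and ?r' = "\<lambda>x. 1 / (complex_of_real x - \<i>)"
  have w: "cayley x = 1 + (-2 * \<i>) * ?r x" for x
    using real_plus_i_nonzero[of x] by (simp add: cayley_def divide_simps)
  have wc: "cnj (cayley x) = 1 + (2 * \<i>) * ?r' x" for x
    by (simp add: w)
  have h_cnj: "complex_of_real (h z) = (z + cnj z) / 2 * h 1 + (z - cnj z) / (2 * \<i>) * h \<i>" for z
    by (subst h_eq) (simp add: complex_eq_iff)
  have "((1 + (-2 * \<i>) * r) + (1 + (2 * \<i>) * r')) / 2 * a + ((1 + (-2 * \<i>) * r) - (1 + (2 * \<i>) * r')) / (2 * \<i>) * b
      = a + (a * (- \<i>) + - b) * r + (a * \<i> + - b) * r'" for a b r r'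
    by (simp add: divide_simps algebra_simps)
  then have "complex_of_real (h (cayley x)) =
      h 1 + (h 1 * (- \<i>) + - complex_of_real (h \<i>)) * ?r x + (h 1 * \<i> + - complex_of_real (h \<i>)) * ?r' x" for x
    unfolding h_cnj[of "cayley x"] wc unfolding w .
  moreover have "bounded_separable ?r" "bounded_separable ?r'"
    by (rule bounded_separable_resolvent; simp)+
  ultimately show ?case
    by (simp only:) (intro bounded_separable_add bounded_separable_mult bounded_separable_const)
qed (auto intro: bounded_separable_add bounded_separable_mult bounded_separable_const)

lemma polynomial_function_Re_Im:
  fixes g :: "'a::real_normed_vector \<Rightarrow> complex"
  assumes "polynomial_function g"
  shows "real_polynomial_function (\<lambda>x. Re (g x))" "real_polynomial_function (\<lambda>x. Im (g x))"
  using assms bounded_linear_Re bounded_linear_Im unfolding polynomial_function_def comp_def by blast+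

text \<open>Pulled back by the inverse Cayley map \<open>c\<close>, a function of bounded support
  vanishes near the point 1 and so extends continuously to the whole circle, where a polynomial
  approximates it.\<close>

lemma bounded_separable_dense:
  fixes F :: "complex \<Rightarrow> complex"
  assumes F: "continuous_on UNIV F" and supp: "bounded {z. F z \<noteq> 0}" and e: "0 < e"
  obtains G where "bounded_separable G" "\<And>x. cmod (F (complex_of_real x) - G x) < e"
proof -
  define c where "c z = \<i> * (1 + z) / (1 - z)" for z :: complex
  define H where "H z = (if z = 1 then 0 else F (c z))" for z
  obtain K where "0 < K" and "\<forall>z\<in>{z. F z \<noteq> 0}. cmod z \<le> K"
    using supp unfolding bounded_pos by blast
  then have K: "0 < K" "\<And>z. F z \<noteq> 0 \<Longrightarrow> cmod z \<le> K" by simp_all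
  have "isCont H z" for z
  proof (cases "z = 1")
    case False
    have "isCont c z" unfolding c_def using False by (intro continuous_intros) auto
    moreover have "isCont F (c z)" using F by (simp add: continuous_on_eq_continuous_at)
    ultimately have "isCont (\<lambda>z. F (c z)) z" by (rule isCont_o2)
    moreover have "\<forall>\<^sub>F x in nhds z. F (c x) = H x"
      using t1_space_nhds[OF False] by eventually_elim (auto simp: H_def)
    ultimately show ?thesis by (simp add: isCont_cong)
  next
    case True
    \<comment> \<open>At z = 1 the numerator of \<open>c\<close> tends to 2i and the denominator to
      0, so \<open>c z\<close> eventually leaves the disc of radius K outside which \<open>F\<close>
      is zero.\<close>
    have "filterlim c at_infinity (at 1)"
      unfolding c_def
      by (rule filterlim_divide_at_infinity[where c = "2 * \<i>"])
         (auto intro!: tendsto_eq_intros simp: filterlim_at eventually_at_filter)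
    then have "\<forall>\<^sub>F z in at 1. cmod (c z) \<ge> K + 1"
      using filterlim_at_infinity[of 0 c "at 1"] K(1) by auto
    then have "\<forall>\<^sub>F z in at 1. H z = 0"
      by eventually_elim (use K in \<open>force simp: H_def\<close>)
    then have "(H \<longlongrightarrow> 0) (at 1)" by (rule tendsto_eventually)
    then show ?thesis unfolding True isCont_def by (simp add: H_def)
  qed
  then have "continuous_on (sphere 0 1) H" by (simp add: continuous_at_imp_continuous_on)
  then obtain g where g: "polynomial_function g" "\<And>z. z \<in> sphere 0 1 \<Longrightarrow> norm (H z - g z) < e"
    using Stone_Weierstrass_polynomial_function[OF compact_sphere _ e] by metis
  \<comment> \<open>Split into real and imaginary part because the closure lemma speaks of real
    polynomial functions.\<close>
  define G where "G x = complex_of_real (Re (g (cayley x))) + \<i> * complex_of_real (Im (g (cayley x)))" for x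
  have G: "G x = g (cayley x)" for x by (simp add: G_def complex_eq_iff)
  have "bounded_separable G"
    unfolding G_def
    by (intro bounded_separable_add bounded_separable_mult bounded_separable_const
        bounded_separable_polynomial_cayley polynomial_function_Re_Im g)
  moreover have "H (cayley x) = F (complex_of_real x)" for x
    by (simp add: H_def cayley_neq_1 c_def cayley_inverse)
  then have "cmod (F (complex_of_real x) - G x) < e" for x
    using g(2)[OF cayley_in_sphere[of x]] by (simp add: G)
  ultimately show ?thesis using that by blast
qed

subsection \<open>Trigonometric polynomials and matrix powers\<close>

definition trig_poly :: "nat \<Rightarrow> (int \<Rightarrow> complex) \<Rightarrow> real \<Rightarrow> complex" where
  "trig_poly r c \<theta> = (\<Sum>j\<in>{- int r..int r}. c j * exp (\<i> * of_int j * complex_of_real \<theta>))"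

lemma continuous_on_trig_poly: "continuous_on S (trig_poly r c)"
  unfolding trig_poly_def by (intro continuous_intros)

lemma integrable_circ_continuous:
  fixes g :: "real \<Rightarrow> complex"
  assumes "continuous_on {-pi..pi} g"
  shows "integrable circ g"
proof -
  have "bounded (g ` {-pi..pi})"
    by (rule compact_imp_bounded[OF compact_continuous_image[OF assms]]) simp
  then obtain B where "\<And>\<theta>. \<theta> \<in> {-pi..pi} \<Longrightarrow> cmod (g \<theta>) \<le> B"
    unfolding bounded_iff by blast
  then have "integrable circ (\<lambda>\<theta>. 1 * g \<theta>)"
    by (rule integrable_circ_mult_bounded[OF circ.integrable_const continuous_borel_measurable_circ[OF assms]])
  then show ?thesis by simp
qed

lemma norm_trig_poly_le: "cmod (trig_poly r c \<theta>) \<le> (\<Sum>j\<in>{- int r..int r}. cmod (c j))"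
  unfolding trig_poly_def by (rule sum_norm_le) (simp add: norm_mult)

lemma fourier_coeff_1: "fourier_coeff (\<lambda>_. 1) k = (if k = 0 then 1 else 0)"
proof (cases "k = 0")
  case True
  then show ?thesis using measure_circ by (simp add: fourier_coeff_circ scaleR_conv_of_real)
next
  case False
  define G where "G \<theta> = exp (- (\<i> * of_int k * complex_of_real \<theta>)) / (- (\<i> * of_int k))" for \<theta> :: real
  have "((\<lambda>\<theta>. exp (- (\<i> * of_int k * complex_of_real \<theta>))) has_integral (G pi - G (- pi))) {-pi..pi}"
  proof (rule fundamental_theorem_of_calculus)
    fix \<theta>
    show "(G has_vector_derivative exp (- (\<i> * of_int k * complex_of_real \<theta>))) (at \<theta> within {-pi..pi})"
      unfolding G_def
    proof (rule has_vector_derivative_real_field)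
      show "((\<lambda>z. exp (- (\<i> * of_int k * z)) / (- (\<i> * of_int k))) has_field_derivative
          exp (- (\<i> * of_int k * complex_of_real \<theta>))) (at (complex_of_real \<theta>))"
        using False by (auto intro!: derivative_eq_intros)
    qed
  qed simp
  \<comment> \<open>The exponents at pi and -pi differ by -2 pi i k, hence the witness -k.\<close>
  moreover have "exp (- (\<i> * of_int k * complex_of_real pi)) = exp (- (\<i> * of_int k * complex_of_real (- pi)))"
    unfolding exp_eq by (rule exI[of _ "- k"]) simp
  then have "G pi = G (- pi)" by (simp add: G_def)
  moreover have "(LINT \<theta>|circ. exp (- (\<i> * of_int k * complex_of_real \<theta>))) =
      integral {-pi..pi} (\<lambda>\<theta>. exp (- (\<i> * of_int k * complex_of_real \<theta>)))"
    unfolding circ_def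
    by (intro lebesgue_integral_eq_integral)
      (auto simp flip: circ_def intro!: integrable_circ_continuous continuous_intros)
  ultimately show ?thesis using False by (simp add: fourier_coeff_circ integral_unique)
qed

text \<open>The convolution rule for one polynomial factor: each exponential shifts the
  coefficients, and linearity handles the finite sum.\<close>

lemma fourier_coeff_trig_poly_mult:
  assumes g: "integrable circ g"
  shows "fourier_coeff (\<lambda>\<theta>. trig_poly r c \<theta> * g \<theta>) k = (\<Sum>j\<in>{- int r..int r}. c j * fourier_coeff g (k - j))"
proof -
  have "trig_poly r c \<theta> * g \<theta> * exp (- (\<i> * of_int k * complex_of_real \<theta>)) =
    (\<Sum>j\<in>{- int r..int r}. c j * (g \<theta> * exp (- (\<i> * of_int (k - j) * complex_of_real \<theta>))))" for \<theta>
  proof -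
    have e: "exp (- (\<i> * of_int (k - j) * complex_of_real \<theta>)) =
        exp (\<i> * of_int j * complex_of_real \<theta>) * exp (- (\<i> * of_int k * complex_of_real \<theta>))" for j
      by (simp add: algebra_simps flip: exp_add)
    show ?thesis unfolding trig_poly_def sum_distrib_right e by (simp only: mult_ac)
  qed
  then show ?thesis
    using integrable_circ_mult_exp[OF g]
    by (simp add: fourier_coeff_circ Bochner_Integration.integral_sum sum_divide_distrib
        del: of_int_diff)
qed

lemma fourier_coeff_trig_poly:
  "fourier_coeff (trig_poly r c) k = (if \<bar>k\<bar> \<le> int r then c k else 0)"
proof -
  have "fourier_coeff (trig_poly r c) k = fourier_coeff (\<lambda>\<theta>. trig_poly r c \<theta> * 1) k" by simp
  also have "\<dots> = (\<Sum>j\<in>{- int r..int r}. c j * (if k - j = 0 then 1 else 0))"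
    by (subst fourier_coeff_trig_poly_mult) (simp_all add: fourier_coeff_1)
  also have "\<dots> = (\<Sum>j\<in>{- int r..int r}. if k = j then c j else 0)"
    by (rule sum.cong) auto
  also have "\<dots> = (if \<bar>k\<bar> \<le> int r then c k else 0)"
    by (simp add: sum.delta' abs_le_iff)
  finally show ?thesis .
qed

lemma cnj_trig_poly:
  assumes "\<And>j. c j \<in> \<real>"
  shows "cnj (trig_poly r c \<theta>) = trig_poly r (\<lambda>j. c (- j)) \<theta>"
proof -
  have "cnj (c j) = c j" for j using assms by (simp add: Reals_cnj_iff)
  then have "cnj (trig_poly r c \<theta>) = (\<Sum>j\<in>{- int r..int r}. c j * exp (\<i> * of_int (- j) * complex_of_real \<theta>))"
    by (simp add: trig_poly_def exp_cnj)
  also have "\<dots> = (\<Sum>j\<in>{- int r..int r}. c (- j) * exp (\<i> * of_int j * complex_of_real \<theta>))"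
    by (rule sum.reindex_bij_witness[of _ uminus uminus]) auto
  finally show ?thesis by (simp add: trig_poly_def)
qed

section \<open>Powers, traces and spectral bounds of Hermitian arrays\<close>

fun array_power :: "nat \<Rightarrow> (nat \<Rightarrow> nat \<Rightarrow> complex) \<Rightarrow> nat \<Rightarrow> nat \<Rightarrow> nat \<Rightarrow> complex" where
  "array_power n a 0 s t = (if s = t then 1 else 0)"
| "array_power n a (Suc k) s t = (\<Sum>u<n. a s u * array_power n a k u t)"

lemma array_power_eigenbasis:
  assumes u: "eigenbasis n a u l" and "s < n" "t < n"
  shows "array_power n a k s t = (\<Sum>i<n. l i ^ k * u i s * cnj (u i t))"
  using assms(2,3)
proof (induction k arbitrary: s)
  case 0
  then show ?case using u by (simp add: eigenbasis_def unitary_array_def)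
next
  case (Suc k)
  have "array_power n a (Suc k) s t = (\<Sum>v<n. a s v * (\<Sum>i<n. l i ^ k * u i v * cnj (u i t)))"
    using Suc by simp
  also have "\<dots> = (\<Sum>v<n. \<Sum>i<n. l i ^ k * cnj (u i t) * (a s v * u i v))"
    by (simp add: sum_distrib_left mult_ac)
  also have "\<dots> = (\<Sum>i<n. l i ^ k * cnj (u i t) * (\<Sum>v<n. a s v * u i v))"
    by (subst sum.swap) (simp add: sum_distrib_left)
  also have "\<dots> = (\<Sum>i<n. l i ^ k * cnj (u i t) * (l i * u i s))"
    using u Suc.prems by (simp add: eigenbasis_def)
  finally show ?case by (simp add: mult_ac)
qed

lemma trace_array_power:
  assumes u: "eigenbasis n a u l"
  shows "(\<Sum>t<n. array_power n a k t t) = (\<Sum>i<n. complex_of_real (l i ^ k))"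
proof -
  have "(\<Sum>t<n. array_power n a k t t) = (\<Sum>t<n. \<Sum>i<n. l i ^ k * u i t * cnj (u i t))"
    using array_power_eigenbasis[OF u] by simp
  also have "\<dots> = (\<Sum>i<n. l i ^ k * (\<Sum>t<n. u i t * cnj (u i t)))"
    by (subst sum.swap) (simp add: sum_distrib_left mult_ac)
  also have "\<dots> = (\<Sum>i<n. complex_of_real (l i ^ k))"
    using u by (simp add: eigenbasis_def unitary_array_def)
  finally show ?thesis .
qed

lemma norm_array_power_le:
  assumes "\<And>s. s < n \<Longrightarrow> (\<Sum>u<n. cmod (a s u)) \<le> B" "s < n"
  shows "cmod (array_power n a k s t) \<le> B ^ k"
  using assms(2)
proof (induction k arbitrary: s)
  case (Suc k)
  have "0 \<le> (\<Sum>u<n. cmod (a s u))" by (simp add: sum_nonneg)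
  then have B: "0 \<le> B" using assms(1)[OF Suc.prems] by linarith
  have "cmod (array_power n a (Suc k) s t) \<le> (\<Sum>u<n. cmod (a s u) * B ^ k)"
    unfolding array_power.simps
    by (rule sum_norm_le) (use Suc.IH in \<open>auto simp: norm_mult intro!: mult_left_mono\<close>)
  also have "\<dots> \<le> B * B ^ k"
    unfolding sum_distrib_right[symmetric] using assms(1)[OF Suc.prems] B by (intro mult_right_mono) auto
  finally show ?case by simp
qed simp

text \<open>Schur test: the eigenvalue is the quadratic form at a unit eigenvector, 2xy <= x^2 + y^2
  charges each entry half to its row and half to its column, and Hermitian symmetry gives columns
  the same absolute sums as rows.\<close>

lemma eigenbasis_abs_le:
  assumes u: "eigenbasis n a u l" and herm: "\<And>s t. s < n \<Longrightarrow> t < n \<Longrightarrow> a t s = cnj (a s t)"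
    and B: "\<And>s. s < n \<Longrightarrow> (\<Sum>t<n. cmod (a s t)) \<le> B" and i: "i < n"
  shows "\<bar>l i\<bar> \<le> B"
proof -
  have nrm: "(\<Sum>s<n. (cmod (u i s))\<^sup>2) = 1"
  proof -
    have "complex_of_real (\<Sum>s<n. (cmod (u i s))\<^sup>2) = (\<Sum>s<n. u i s * cnj (u i s))"
      by (simp only: of_real_sum complex_norm_square)
    also have "\<dots> = complex_of_real 1" using u i by (simp add: eigenbasis_def unitary_array_def)
    finally show ?thesis unfolding of_real_eq_iff .
  qed
  have "complex_of_real (l i) = complex_of_real (l i) * complex_of_real (\<Sum>s<n. (cmod (u i s))\<^sup>2)"
    by (simp only: nrm) simp
  also have "\<dots> = complex_of_real (l i) * (\<Sum>s<n. u i s * cnj (u i s))"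
    by (simp only: of_real_sum complex_norm_square)
  also have "\<dots> = (\<Sum>s<n. cnj (u i s) * (l i * u i s))"
    by (simp add: sum_distrib_left mult_ac)
  also have "\<dots> = (\<Sum>s<n. cnj (u i s) * (\<Sum>t<n. a s t * u i t))"
    using u i by (simp add: eigenbasis_def)
  also have "\<dots> = (\<Sum>s<n. \<Sum>t<n. cnj (u i s) * (a s t * u i t))"
    by (simp only: sum_distrib_left)
  finally have l_eq: "complex_of_real (l i) = (\<Sum>s<n. \<Sum>t<n. cnj (u i s) * (a s t * u i t))" .
  have "\<bar>l i\<bar> = cmod (\<Sum>s<n. \<Sum>t<n. cnj (u i s) * (a s t * u i t))"
    unfolding l_eq[symmetric] by simp
  also have "\<dots> \<le> (\<Sum>s<n. \<Sum>t<n. cmod (a s t) * ((cmod (u i s))\<^sup>2 + (cmod (u i t))\<^sup>2) / 2)"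
  proof (intro sum_norm_le)
    fix s t
    have "cmod (u i s) * cmod (u i t) \<le> ((cmod (u i s))\<^sup>2 + (cmod (u i t))\<^sup>2) / 2"
      using sum_squares_bound[of "cmod (u i s)" "cmod (u i t)"] by simp
    from mult_left_mono[OF this, of "cmod (a s t)"]
    show "cmod (cnj (u i s) * (a s t * u i t)) \<le> cmod (a s t) * ((cmod (u i s))\<^sup>2 + (cmod (u i t))\<^sup>2) / 2"
      by (simp add: norm_mult mult_ac)
  qed
  also have "\<dots> = (\<Sum>s<n. \<Sum>t<n. cmod (a s t) * (cmod (u i s))\<^sup>2) / 2 + (\<Sum>s<n. \<Sum>t<n. cmod (a s t) * (cmod (u i t))\<^sup>2) / 2"
    by (simp add: distrib_left add_divide_distrib sum.distrib sum_divide_distrib)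
  also have "(\<Sum>s<n. \<Sum>t<n. cmod (a s t) * (cmod (u i t))\<^sup>2) = (\<Sum>s<n. \<Sum>t<n. cmod (a t s) * (cmod (u i s))\<^sup>2)"
    by (rule sum.swap)
  also have "\<dots> = (\<Sum>s<n. \<Sum>t<n. cmod (a s t) * (cmod (u i s))\<^sup>2)"
  proof (intro sum.cong refl)
    fix s t assume "s \<in> {..<n}" "t \<in> {..<n}"
    then have "cmod (a t s) = cmod (a s t)" using herm[of s t] by simp
    then show "cmod (a t s) * (cmod (u i s))\<^sup>2 = cmod (a s t) * (cmod (u i s))\<^sup>2" by simp
  qed
  also have "(\<Sum>s<n. \<Sum>t<n. cmod (a s t) * (cmod (u i s))\<^sup>2) / 2 + (\<Sum>s<n. \<Sum>t<n. cmod (a s t) * (cmod (u i s))\<^sup>2) / 2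
      = (\<Sum>s<n. (\<Sum>t<n. cmod (a s t)) * (cmod (u i s))\<^sup>2)"
    by (simp add: sum_distrib_right)
  also have "\<dots> \<le> (\<Sum>s<n. B * (cmod (u i s))\<^sup>2)"
    using B by (intro sum_mono mult_right_mono) auto
  also have "\<dots> = B" by (simp add: nrm flip: sum_distrib_left)
  finally show ?thesis .
qed

subsection \<open>Eigenvalue averages for trigonometric polynomials\<close>

text \<open>Away from the boundary the entries of the \<open>k\<close>-th power of the Hankel matrix of \<open>p\<close> are
  Fourier coefficients of the alternating product \<open>\<dots> p cnj(p) p\<close> with \<open>k\<close> factors: it is a Toeplitz
  matrix for even \<open>k\<close> and a Hankel matrix, concentrated near the antidiagonal, for odd \<open>k\<close>.\<close>

fun moment_symbol :: "(real \<Rightarrow> complex) \<Rightarrow> nat \<Rightarrow> real \<Rightarrow> complex" where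
  "moment_symbol p 0 \<theta> = 1"
| "moment_symbol p (Suc k) \<theta> = (if even k then p \<theta> else cnj (p \<theta>)) * moment_symbol p k \<theta>"

lemma moment_symbol_even: "moment_symbol p (2 * m) \<theta> = complex_of_real (cmod (p \<theta>) ^ (2 * m))"
proof (induction m)
  case (Suc m)
  have "moment_symbol p (2 * Suc m) \<theta> = (p \<theta> * cnj (p \<theta>)) * moment_symbol p (2 * m) \<theta>" by simp
  also have "\<dots> = complex_of_real ((cmod (p \<theta>))\<^sup>2) * complex_of_real (cmod (p \<theta>) ^ (2 * m))"
    by (simp only: complex_norm_square Suc.IH)
  finally show ?case by (simp add: power2_eq_square)
qed simp

lemma integrable_moment_symbol: "integrable circ (moment_symbol (trig_poly r c) k)"
proof (rule integrable_circ_continuous)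
  show "continuous_on {-pi..pi} (moment_symbol (trig_poly r c) k)"
  proof (induction k)
    case (Suc k)
    then show ?case by (cases "even k") (auto intro!: continuous_intros continuous_on_trig_poly)
  qed simp
qed

text \<open>For real \<open>c\<close> the polynomial cnj p has coefficients c(-j), so conjugation
  reverses the shift. This alternation is the one produced by multiplying Hankel matrices, where
  indices s - t and n - 1 - s - t take turns.\<close>

lemma fourier_coeff_moment_symbol_Suc:
  assumes c: "\<And>j. c j \<in> \<real>"
  shows "fourier_coeff (moment_symbol (trig_poly r c) (Suc k)) d =
    (\<Sum>j\<in>{- int r..int r}. c j * fourier_coeff (moment_symbol (trig_poly r c) k) (if even k then d - j else d + j))"
proof (cases "even k")
  case True
  then have "moment_symbol (trig_poly r c) (Suc k) =
      (\<lambda>\<theta>. trig_poly r c \<theta> * moment_symbol (trig_poly r c) k \<theta>)" by auto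
  with True show ?thesis by (simp add: fourier_coeff_trig_poly_mult integrable_moment_symbol del: moment_symbol.simps)
next
  case False
  then have "moment_symbol (trig_poly r c) (Suc k) =
      (\<lambda>\<theta>. trig_poly r (\<lambda>j. c (- j)) \<theta> * moment_symbol (trig_poly r c) k \<theta>)"
    by (auto simp: cnj_trig_poly[OF c])
  then have "fourier_coeff (moment_symbol (trig_poly r c) (Suc k)) d =
    (\<Sum>j\<in>{- int r..int r}. c (- j) * fourier_coeff (moment_symbol (trig_poly r c) k) (d - j))"
    by (simp add: fourier_coeff_trig_poly_mult integrable_moment_symbol del: moment_symbol.simps)
  also have "\<dots> = (\<Sum>j\<in>{- int r..int r}. c j * fourier_coeff (moment_symbol (trig_poly r c) k) (d + j))"
    by (rule sum.reindex_bij_witness[of _ uminus uminus]) auto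
  finally show ?thesis using False by simp
qed

lemma fourier_coeff_moment_symbol_eq_0:
  assumes c: "\<And>j. c j \<in> \<real>" and d: "int (k * r) < \<bar>d\<bar>"
  shows "fourier_coeff (moment_symbol (trig_poly r c) k) d = 0"
  using d
proof (induction k arbitrary: d)
  case 0
  have "moment_symbol (trig_poly r c) 0 = (\<lambda>_. 1)" by auto
  then show ?case using 0 by (simp add: fourier_coeff_1 del: moment_symbol.simps)
next
  case (Suc k)
  have "fourier_coeff (moment_symbol (trig_poly r c) k) (if even k then d - j else d + j) = 0"
    if "j \<in> {- int r..int r}" for j
    using that Suc.prems by (intro Suc.IH) auto
  then show ?case unfolding fourier_coeff_moment_symbol_Suc[OF c] by (intro sum.neutral) simp
qed

text \<open>One more Hankel factor on the left reproduces the convolution recursion of the moment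
  symbol, provided no term is lost at the borders of the matrix. Keeping the column t at distance k
  r from both ends ensures this; the row s is arbitrary, which is what lets the induction sum over
  all intermediate rows.\<close>

lemma array_power_interior:
  assumes c: "\<And>j. c j \<in> \<real>" and "s < n" "k * r \<le> t" "t + k * r < n"
  shows "array_power n (hankel_coeff (trig_poly r c) n) k s t =
    fourier_coeff (moment_symbol (trig_poly r c) k) (if even k then int s - int t else int n - 1 - int s - int t)"
  using assms(2-)
proof (induction k arbitrary: s)
  case 0
  have "moment_symbol (trig_poly r c) 0 = (\<lambda>_. 1)" by auto
  then show ?case by (simp add: fourier_coeff_1 del: moment_symbol.simps)
next
  case (Suc k)
  define g where "g = fourier_coeff (moment_symbol (trig_poly r c) k)"
  define h where "h j = (if \<bar>j\<bar> \<le> int r then c j else 0) *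
    g (if even k then int n - 1 - int s - int t - j else int s - int t + j)" for j
  have t: "int k * int r \<le> int t" "int t + int k * int r < int n"
    using Suc.prems(2,3) by (simp_all flip: of_nat_mult of_nat_add)
  \<comment> \<open>These d correspond to intermediate rows u < 0 or u >= n. There the frequency
    exceeds the degree k r of the symbol, so the sum over 0 <= u < n is already complete.\<close>
  have g0: "g d = 0" if "d < - int t \<or> int n - int t \<le> d" for d
    unfolding g_def using that t by (intro fourier_coeff_moment_symbol_eq_0[OF c]) auto
  have "array_power n (hankel_coeff (trig_poly r c) n) (Suc k) s t = (\<Sum>u<n. h (int n - 1 - int s - int u))"
    unfolding array_power.simps
  proof (rule sum.cong[OF refl])
    fix u assume "u \<in> {..<n}"
    then have "array_power n (hankel_coeff (trig_poly r c) n) k u t =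
        g (if even k then int u - int t else int n - 1 - int u - int t)"
      unfolding g_def using Suc.prems by (intro Suc.IH) auto
    then show "hankel_coeff (trig_poly r c) n s u * array_power n (hankel_coeff (trig_poly r c) n) k u t =
        h (int n - 1 - int s - int u)"
      by (simp add: h_def hankel_coeff_def fourier_coeff_trig_poly algebra_simps)
  qed
  also have "\<dots> = (\<Sum>j\<in>{- int s..int n - 1 - int s}. h j)"
    by (rule sum.reindex_bij_witness[of _ "\<lambda>j. nat (int n - 1 - int s - j)" "\<lambda>u. int n - 1 - int s - int u"]) auto
  also have "\<dots> = (\<Sum>j\<in>{- int s..int n - 1 - int s} \<inter> {- int r..int r}. h j)"
    by (rule sum.mono_neutral_right) (auto simp: h_def)
  also have "\<dots> = (\<Sum>j\<in>{- int r..int r}. h j)"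
  proof (rule sum.mono_neutral_left)
    show "\<forall>j\<in>{- int r..int r} - {- int s..int n - 1 - int s} \<inter> {- int r..int r}. h j = 0"
      using Suc.prems(1) by (auto simp: h_def intro!: g0)
  qed auto
  also have "\<dots> = fourier_coeff (moment_symbol (trig_poly r c) (Suc k))
      (if even (Suc k) then int s - int t else int n - 1 - int s - int t)"
    unfolding fourier_coeff_moment_symbol_Suc[OF c]
    by (rule sum.cong) (auto simp: h_def g_def)
  finally show ?case .
qed

text \<open>Along a row the coefficient index takes distinct values, so each coefficient is met at
  most once. The bound does not depend on n or s.\<close>

lemma hankel_trig_poly_row_sum:
  "(\<Sum>t<n. cmod (hankel_coeff (trig_poly r c) n s t)) \<le> (\<Sum>j\<in>{- int r..int r}. cmod (c j))"
proof -
  have "(\<Sum>t<n. cmod (hankel_coeff (trig_poly r c) n s t)) =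
      (\<Sum>j\<in>{- int s..int n - 1 - int s}. if \<bar>j\<bar> \<le> int r then cmod (c j) else 0)"
    unfolding hankel_coeff_def fourier_coeff_trig_poly
    by (rule sum.reindex_bij_witness[of _ "\<lambda>j. nat (int n - 1 - int s - j)" "\<lambda>u. int n - 1 - int s - int u"]) auto
  also have "\<dots> = (\<Sum>j\<in>{- int s..int n - 1 - int s} \<inter> {- int r..int r}. cmod (c j))"
    by (rule sum.mono_neutral_cong_right) auto
  also have "\<dots> \<le> (\<Sum>j\<in>{- int r..int r}. cmod (c j))"
    by (rule sum_mono2) auto
  finally show ?thesis .
qed

lemma average_almost_constant:
  fixes x :: "nat \<Rightarrow> nat \<Rightarrow> complex"
  assumes card: "\<And>n. card {t\<in>{..<n}. x n t \<noteq> L} \<le> K" and B: "\<And>n t. t < n \<Longrightarrow> cmod (x n t) \<le> B"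
  shows "(\<lambda>n. (\<Sum>t<n. x n t) / n) \<longlonglongrightarrow> L"
proof (rule LIM_zero_cancel, rule Lim_null_comparison)
  show "(\<lambda>n. K * \<bar>B + cmod L\<bar> / n) \<longlonglongrightarrow> 0" by (rule lim_const_over_n)
  have bound: "cmod ((\<Sum>t<n. x n t) / n - L) \<le> K * \<bar>B + cmod L\<bar> / n" if "n > 0" for n
  proof -
    let ?D = "{t\<in>{..<n}. x n t \<noteq> L}"
    have "(\<Sum>t<n. x n t) / n - L = (\<Sum>t<n. x n t - L) / n"
      using that by (simp add: sum_subtractf diff_divide_distrib)
    also have "(\<Sum>t<n. x n t - L) = (\<Sum>t\<in>?D. x n t - L)"
      by (rule sum.mono_neutral_right) auto
    finally have "cmod ((\<Sum>t<n. x n t) / n - L) = cmod (\<Sum>t\<in>?D. x n t - L) / n"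
      by (simp add: norm_divide)
    moreover have "cmod (\<Sum>t\<in>?D. x n t - L) \<le> (\<Sum>t\<in>?D. \<bar>B + cmod L\<bar>)"
    proof (rule sum_norm_le)
      fix t assume "t \<in> ?D"
      then show "cmod (x n t - L) \<le> \<bar>B + cmod L\<bar>"
        using B[of t n] norm_triangle_ineq4[of "x n t" L] by auto
    qed
    moreover have "(\<Sum>t\<in>?D. \<bar>B + cmod L\<bar>) \<le> K * \<bar>B + cmod L\<bar>"
      using card[of n] by (simp add: mult_right_mono)
    ultimately show ?thesis by (simp add: divide_right_mono)
  qed
  show "\<forall>\<^sub>F n in sequentially. norm ((\<Sum>t<n. x n t) / n - L) \<le> K * \<bar>B + cmod L\<bar> / n"
    using eventually_gt_at_top[of 0] by eventually_elim (rule bound)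
qed

text \<open>Counts where the diagonal crosses the band around the antidiagonal, the only interior
  places where an odd power can have a nonzero diagonal entry.\<close>

lemma card_near_centre: "card {t\<in>{..<n}. \<bar>int n - 1 - 2 * int t\<bar> \<le> int R} \<le> 2 * R + 1"
proof -
  have "card {t\<in>{..<n}. \<bar>int n - 1 - 2 * int t\<bar> \<le> int R} \<le> card {- int R..int R}"
    by (rule card_inj_on_le[of "\<lambda>t. int n - 1 - 2 * int t"]) (auto simp: inj_on_def)
  then show ?thesis by simp
qed

text \<open>At most k r diagonal positions at either end escape the interior formula, and for odd k
  at most 2 k r + 1 near the centre carry a nonzero coefficient. Their number is independent of n,
  so the average does not see them.\<close>

lemma trace_moment_limit:
  assumes c: "\<And>j. c j \<in> \<real>"
  shows "(\<lambda>n. (\<Sum>t<n. array_power n (hankel_coeff (trig_poly r c) n) k t t) / n)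
    \<longlonglongrightarrow> (if even k then fourier_coeff (moment_symbol (trig_poly r c) k) 0 else 0)" (is "_ \<longlonglongrightarrow> ?L")
proof (rule average_almost_constant)
  let ?x = "\<lambda>n t. array_power n (hankel_coeff (trig_poly r c) n) k t t"
  fix n t :: nat assume "t < n"
  then show "cmod (?x n t) \<le> (\<Sum>j\<in>{- int r..int r}. cmod (c j)) ^ k"
    by (intro norm_array_power_le hankel_trig_poly_row_sum)
next
  let ?x = "\<lambda>n t. array_power n (hankel_coeff (trig_poly r c) n) k t t"
  fix n :: nat
  let ?C = "{t\<in>{..<n}. \<bar>int n - 1 - 2 * int t\<bar> \<le> int (k * r)}"
  have "{t\<in>{..<n}. ?x n t \<noteq> ?L} \<subseteq> {..<k * r} \<union> {n - k * r..<n} \<union> ?C"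
  proof
    fix t assume t: "t \<in> {t\<in>{..<n}. ?x n t \<noteq> ?L}"
    show "t \<in> {..<k * r} \<union> {n - k * r..<n} \<union> ?C"
    proof (rule ccontr)
      assume *: "t \<notin> {..<k * r} \<union> {n - k * r..<n} \<union> ?C"
      then have "k * r \<le> t" "t + k * r < n" using t by auto
      then have "?x n t = fourier_coeff (moment_symbol (trig_poly r c) k) (if even k then 0 else int n - 1 - 2 * int t)"
        using array_power_interior[OF c, of t n k r t] t by (simp add: algebra_simps)
      then show False using * t fourier_coeff_moment_symbol_eq_0[OF c, of k r "int n - 1 - 2 * int t"]
        by (auto split: if_splits)
    qed
  qed
  then have "card {t\<in>{..<n}. ?x n t \<noteq> ?L} \<le> card ({..<k * r} \<union> {n - k * r..<n} \<union> ?C)"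
    by (intro card_mono) auto
  also have "\<dots> \<le> card {..<k * r} + card {n - k * r..<n} + card ?C"
    by (intro order_trans[OF card_Un_le] add_mono card_Un_le order_refl)
  also have "\<dots> \<le> k * r + k * r + (2 * (k * r) + 1)"
    by (intro add_mono card_near_centre) auto
  finally show "card {t\<in>{..<n}. ?x n t \<noteq> ?L} \<le> k * r + k * r + (2 * (k * r) + 1)" .
qed

lemma fourier_coeff_trig_poly_real:
  assumes "\<And>j. c j \<in> \<real>"
  shows "fourier_coeff (trig_poly r c) k \<in> \<real>"
  using assms by (simp add: fourier_coeff_trig_poly)

text \<open>The two signs in \<open>limit_mean\<close> cancel for odd k, matching the vanishing
  trace. For even k they give 2|p|^k, and 2 / (4 pi) is the normalization of the zeroth Fourier
  coefficient.\<close>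

lemma ev_mean_trig_poly_power:
  assumes c: "\<And>j. c j \<in> \<real>"
  shows "(\<lambda>n. ev_mean (trig_poly r c) n (\<lambda>x. complex_of_real x ^ k)) \<longlonglongrightarrow> limit_mean (trig_poly r c) (\<lambda>x. complex_of_real x ^ k)"
proof -
  let ?p = "trig_poly r c"
  have p_real: "fourier_coeff ?p k \<in> \<real>" for k by (rule fourier_coeff_trig_poly_real[OF c])
  have "ev_mean ?p n (\<lambda>x. complex_of_real x ^ k) = (\<Sum>t<n. array_power n (hankel_coeff ?p n) k t t) / n" for n
  proof -
    obtain u l where u: "eigenbasis n (hankel_coeff ?p n) u l"
      and ev: "\<And>F. ev_mean ?p n F = (\<Sum>i<n. F (l i)) / n"
      by (rule ev_mean_eigenbasis[where f = ?p and n = n, OF p_real]) (rule that)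
    show ?thesis by (simp add: ev trace_array_power[OF u])
  qed
  moreover have "limit_mean ?p (\<lambda>x. complex_of_real x ^ k) = (if even k then fourier_coeff (moment_symbol ?p k) 0 else 0)"
  proof (cases "even k")
    case True
    then obtain m where m: "k = 2 * m" by blast
    have "complex_of_real (cmod z) ^ k + complex_of_real (- cmod z) ^ k = 2 * complex_of_real (cmod z ^ k)" for z
      using True by simp
    then have "limit_mean ?p (\<lambda>x. complex_of_real x ^ k) = (LINT \<theta>|circ. 2 * moment_symbol ?p k \<theta>) / (4 * pi)"
      by (simp only: limit_mean_def m moment_symbol_even)
    then show ?thesis using True by (simp add: fourier_coeff_circ)
  qed (simp add: limit_mean_def)
  ultimately show ?thesis using trace_moment_limit[where r = r and k = k, OF c] by simp
qed

lemma norm_diff_triangle3: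
  fixes x :: "'a::real_normed_vector"
  shows "norm (x - y) \<le> norm (x - x') + norm (x' - y') + norm (y - y')"
  using norm_triangle_ineq4[of "(x - x') + (x' - y')" "y - y'"] norm_triangle_ineq[of "x - x'" "x' - y'"]
  by simp

text \<open>Uniform approximation on \<open>S\<close> controls both sides at once, as
  \<open>S\<close> contains all eigenvalues and all values of the symbol. It serves with a compact
  interval for polynomial symbols and with the whole line for integrable ones.\<close>

lemma ev_mean_limit_approx:
  assumes f_real: "\<And>k. fourier_coeff f k \<in> \<real>"
    and spec: "\<And>n u l i. eigenbasis n (hankel_coeff f n) u l \<Longrightarrow> i < n \<Longrightarrow> l i \<in> S"
    and range: "\<And>\<theta>. \<theta> \<in> {-pi..pi} \<Longrightarrow> cmod (f \<theta>) \<in> S \<and> - cmod (f \<theta>) \<in> S"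
    and F: "integrable circ (\<lambda>\<theta>. F (cmod (f \<theta>)) + F (- cmod (f \<theta>)))"
    and approx: "\<And>e. 0 < e \<Longrightarrow> \<exists>G. (\<forall>x\<in>S. cmod (F x - G x) \<le> e) \<and>
      integrable circ (\<lambda>\<theta>. G (cmod (f \<theta>)) + G (- cmod (f \<theta>))) \<and>
      (\<lambda>n. ev_mean f n G) \<longlonglongrightarrow> limit_mean f G"
  shows "(\<lambda>n. ev_mean f n F) \<longlonglongrightarrow> limit_mean f F"
proof (rule LIMSEQ_I)
  fix e :: real assume "0 < e"
  then have e: "0 < e / 4" by simp
  from approx[OF e] obtain G where FG: "\<And>x. x \<in> S \<Longrightarrow> cmod (F x - G x) \<le> e / 4"
    and G: "integrable circ (\<lambda>\<theta>. G (cmod (f \<theta>)) + G (- cmod (f \<theta>)))"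
    and lim: "(\<lambda>n. ev_mean f n G) \<longlonglongrightarrow> limit_mean f G" by blast
  have ev: "cmod (ev_mean f n F - ev_mean f n G) \<le> e / 4" for n
  proof -
    obtain u l where u: "eigenbasis n (hankel_coeff f n) u l"
      and l: "\<And>F. ev_mean f n F = (\<Sum>i<n. F (l i)) / n"
      by (rule ev_mean_eigenbasis[OF f_real, of n]) (rule that)
    have "ev_mean f n F - ev_mean f n G = (\<Sum>i<n. F (l i) - G (l i)) / n"
      by (simp add: l sum_subtractf diff_divide_distrib)
    then have "cmod (ev_mean f n F - ev_mean f n G) = cmod (\<Sum>i<n. F (l i) - G (l i)) / n"
      by (simp only: norm_divide norm_of_nat)
    also have "cmod (\<Sum>i<n. F (l i) - G (l i)) \<le> (\<Sum>i<n. e / 4)"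
      by (rule sum_norm_le) (use FG spec[OF u] in auto)
    finally show ?thesis using e by (cases "n = 0") (auto simp: divide_simps)
  qed
  let ?FG = "\<lambda>\<theta>. (F (cmod (f \<theta>)) + F (- cmod (f \<theta>))) - (G (cmod (f \<theta>)) + G (- cmod (f \<theta>)))"
  have "limit_mean f F - limit_mean f G = (LINT \<theta>|circ. ?FG \<theta>) / (4 * pi)"
    using F G by (simp add: limit_mean_def diff_divide_distrib)
  then have "cmod (limit_mean f F - limit_mean f G) = cmod (LINT \<theta>|circ. ?FG \<theta>) / (4 * pi)"
    by (simp add: norm_divide)
  also have "cmod (LINT \<theta>|circ. ?FG \<theta>) \<le> (LINT \<theta>|circ. cmod (?FG \<theta>))"
    by (rule integral_norm_bound)
  also have "\<dots> \<le> (LINT \<theta>|circ. e / 2)"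
  proof (rule integral_mono)
    show "integrable circ (\<lambda>\<theta>. cmod (?FG \<theta>))" using F G by (intro integrable_norm Bochner_Integration.integrable_diff)
    fix \<theta> assume "\<theta> \<in> space circ"
    then have S: "cmod (f \<theta>) \<in> S" "- cmod (f \<theta>) \<in> S" using range by auto
    have "cmod (?FG \<theta>) \<le> cmod (F (cmod (f \<theta>)) - G (cmod (f \<theta>))) + cmod (F (- cmod (f \<theta>)) - G (- cmod (f \<theta>)))"
      by (rule norm_diff_triangle_ineq)
    then show "cmod (?FG \<theta>) \<le> e / 2" using FG[OF S(1)] FG[OF S(2)] by simp
  qed simp
  finally have lm: "cmod (limit_mean f F - limit_mean f G) \<le> e / 4"
    using measure_circ e by (simp add: divide_simps)
  obtain N where N: "\<And>n. n \<ge> N \<Longrightarrow> cmod (ev_mean f n G - limit_mean f G) < e / 4"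
    using LIMSEQ_D[OF lim e] by blast
  show "\<exists>N. \<forall>n\<ge>N. cmod (ev_mean f n F - limit_mean f F) < e"
  proof (intro exI allI impI)
    fix n assume "n \<ge> N"
    show "cmod (ev_mean f n F - limit_mean f F) < e"
      using norm_diff_triangle3[of "ev_mean f n F" "limit_mean f F" "ev_mean f n G" "limit_mean f G"]
        ev[of n] N[OF \<open>n \<ge> N\<close>] lm e by linarith
  qed
qed

lemma ev_mean_trig_poly_polynomial:
  assumes c: "\<And>j. c j \<in> \<real>" and G: "polynomial_function (G :: real \<Rightarrow> complex)"
  shows "(\<lambda>n. ev_mean (trig_poly r c) n G) \<longlonglongrightarrow> limit_mean (trig_poly r c) G"
proof -
  let ?p = "trig_poly r c"
  have p_real: "fourier_coeff ?p k \<in> \<real>" for k by (rule fourier_coeff_trig_poly_real[OF c])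
  from polynomial_function_Re_Im[OF G] obtain a b m k where a: "(\<lambda>x. Re (G x)) = (\<lambda>x. \<Sum>i\<le>m. a i * x ^ i)" and b: "(\<lambda>x. Im (G x)) = (\<lambda>x. \<Sum>i\<le>k. b i * x ^ i)"
    unfolding real_polynomial_function_iff_sum by blast
  define P where "P i x = complex_of_real x ^ i" for i x
  have G_eq: "G x = (\<Sum>i\<le>m. a i * P i x) + (\<Sum>i\<le>k. (\<i> * b i) * P i x)" for x
  proof -
    have "G x = complex_of_real (Re (G x)) + \<i> * complex_of_real (Im (G x))" by (simp add: complex_eq_iff)
    also have "Re (G x) = (\<Sum>i\<le>m. a i * x ^ i)" using a by (rule fun_cong)
    also have "Im (G x) = (\<Sum>i\<le>k. b i * x ^ i)" using b by (rule fun_cong)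
    finally show ?thesis by (simp add: P_def sum_distrib_left mult.assoc)
  qed
  have ev: "ev_mean ?p n G = (\<Sum>i\<le>m. a i * ev_mean ?p n (P i)) + (\<Sum>i\<le>k. (\<i> * b i) * ev_mean ?p n (P i))" for n
  proof -
    obtain u l where l: "\<And>F. ev_mean ?p n F = (\<Sum>i<n. F (l i)) / n"
      by (rule ev_mean_eigenbasis[where f = ?p and n = n, OF p_real]) (rule that)
    show ?thesis
      unfolding l G_eq sum.distrib add_divide_distrib
      by (subst (1 2) sum.swap) (simp add: sum_distrib_left sum_divide_distrib)
  qed
  have int: "integrable circ (\<lambda>\<theta>. P i (cmod (?p \<theta>)) + P i (- cmod (?p \<theta>)))" for i
    unfolding P_def by (intro integrable_circ_continuous continuous_intros continuous_on_trig_poly)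
  have "limit_mean ?p G = (LINT \<theta>|circ. (\<Sum>i\<le>m. a i * (P i (cmod (?p \<theta>)) + P i (- cmod (?p \<theta>)))) +
      (\<Sum>i\<le>k. (\<i> * b i) * (P i (cmod (?p \<theta>)) + P i (- cmod (?p \<theta>))))) / (4 * pi)"
    unfolding limit_mean_def G_eq by (simp add: distrib_left sum.distrib add_ac)
  also have "\<dots> = (\<Sum>i\<le>m. a i * limit_mean ?p (P i)) + (\<Sum>i\<le>k. (\<i> * b i) * limit_mean ?p (P i))"
    using int by (simp add: limit_mean_def Bochner_Integration.integral_sum sum_divide_distrib add_divide_distrib)
  finally have "limit_mean ?p G = (\<Sum>i\<le>m. a i * limit_mean ?p (P i)) + (\<Sum>i\<le>k. (\<i> * b i) * limit_mean ?p (P i))" .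
  moreover have "(\<lambda>n. ev_mean ?p n (P i)) \<longlonglongrightarrow> limit_mean ?p (P i)" for i
    unfolding P_def by (rule ev_mean_trig_poly_power[OF c])
  ultimately show ?thesis unfolding ev by (auto intro!: tendsto_intros)
qed

text \<open>The method of moments works because the row sums confine all spectra, for every n, to
  one interval [-B, B], on which polynomials are uniformly dense.\<close>

lemma ev_mean_trig_poly:
  assumes c: "\<And>j. c j \<in> \<real>" and F: "continuous_on UNIV (F :: real \<Rightarrow> complex)"
  shows "(\<lambda>n. ev_mean (trig_poly r c) n F) \<longlonglongrightarrow> limit_mean (trig_poly r c) F"
proof -
  let ?p = "trig_poly r c"
  have p_real: "fourier_coeff ?p k \<in> \<real>" for k by (rule fourier_coeff_trig_poly_real[OF c])
  define B where "B = (\<Sum>j\<in>{- int r..int r}. cmod (c j))"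
  have int: "integrable circ (\<lambda>\<theta>. H (cmod (?p \<theta>)) + H (- cmod (?p \<theta>)))"
    if "continuous_on UNIV H" for H :: "real \<Rightarrow> complex"
    by (intro integrable_circ_continuous continuous_intros continuous_on_compose2[OF that] continuous_on_trig_poly) auto
  show ?thesis
  proof (rule ev_mean_limit_approx[OF p_real, where S = "{-B..B}"])
    fix n u l i assume "eigenbasis n (hankel_coeff ?p n) u l" "i < n"
    then have "\<bar>l i\<bar> \<le> B" unfolding B_def
      by (intro eigenbasis_abs_le[OF _ hankel_coeff_hermitian[OF p_real] hankel_trig_poly_row_sum])
    then show "l i \<in> {-B..B}" by auto
  next
    fix \<theta> show "cmod (?p \<theta>) \<in> {-B..B} \<and> - cmod (?p \<theta>) \<in> {-B..B}"
      using norm_trig_poly_le[of r c \<theta>] norm_ge_zero[of "?p \<theta>"]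
      unfolding B_def[symmetric] atLeastAtMost_iff by (intro conjI; linarith)
  next
    show "integrable circ (\<lambda>\<theta>. F (cmod (?p \<theta>)) + F (- cmod (?p \<theta>)))" by (rule int[OF F])
  next
    fix e :: real assume "0 < e"
    then obtain G where "polynomial_function G" "\<And>x. x \<in> {-B..B} \<Longrightarrow> norm (F x - G x) < e"
      using Stone_Weierstrass_polynomial_function[of "{-B..B}" F e] continuous_on_subset[OF F] by auto
    then show "\<exists>G. (\<forall>x\<in>{-B..B}. cmod (F x - G x) \<le> e) \<and>
        integrable circ (\<lambda>\<theta>. G (cmod (?p \<theta>)) + G (- cmod (?p \<theta>))) \<and>
        (\<lambda>n. ev_mean ?p n G) \<longlonglongrightarrow> limit_mean ?p G"
      by (intro exI[of _ G] conjI ballI int ev_mean_trig_poly_polynomial[OF c] continuous_on_polymonial_function)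
        (auto intro: less_imp_le)
  qed
qed

subsection \<open>Approximation in the mean by trigonometric polynomials\<close>

definition is_trig_poly :: "(real \<Rightarrow> complex) \<Rightarrow> bool" where
  "is_trig_poly P \<longleftrightarrow> (\<exists>r c. P = trig_poly r c)"

lemma trig_poly_pad:
  assumes "r \<le> R"
  shows "trig_poly r c = trig_poly R (\<lambda>j. if \<bar>j\<bar> \<le> int r then c j else 0)"
proof
  fix \<theta>
  show "trig_poly r c \<theta> = trig_poly R (\<lambda>j. if \<bar>j\<bar> \<le> int r then c j else 0) \<theta>"
    unfolding trig_poly_def using assms by (intro sum.mono_neutral_cong_left) auto
qed

lemma is_trig_poly_add:
  assumes "is_trig_poly P" "is_trig_poly Q"
  shows "is_trig_poly (\<lambda>\<theta>. P \<theta> + Q \<theta>)"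
proof -
  obtain r c r' c' where P: "P = trig_poly r c" and Q: "Q = trig_poly r' c'"
    using assms unfolding is_trig_poly_def by blast
  let ?R = "max r r'"
  have "(\<lambda>\<theta>. P \<theta> + Q \<theta>) = trig_poly ?R (\<lambda>j. (if \<bar>j\<bar> \<le> int r then c j else 0) + (if \<bar>j\<bar> \<le> int r' then c' j else 0))"
    unfolding P Q trig_poly_pad[of r ?R, OF max.cobounded1] trig_poly_pad[of r' ?R, OF max.cobounded2]
    by (auto simp: trig_poly_def sum.distrib distrib_right)
  then show ?thesis unfolding is_trig_poly_def by blast
qed

lemma is_trig_poly_mult_exp:
  assumes "is_trig_poly P"
  shows "is_trig_poly (\<lambda>\<theta>. b * exp (\<i> * of_int k * complex_of_real \<theta>) * P \<theta>)"
proof -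
  obtain r c where P: "P = trig_poly r c" using assms unfolding is_trig_poly_def by blast
  define c' where "c' j = (if \<bar>j - k\<bar> \<le> int r then b * c (j - k) else 0)" for j
  have "b * exp (\<i> * of_int k * complex_of_real \<theta>) * P \<theta> = trig_poly (r + nat \<bar>k\<bar>) c' \<theta>" for \<theta>
  proof -
    have e: "exp (\<i> * of_int (j + k) * complex_of_real \<theta>) =
        exp (\<i> * of_int k * complex_of_real \<theta>) * exp (\<i> * of_int j * complex_of_real \<theta>)" for j
      by (simp add: algebra_simps flip: exp_add)
    have "b * exp (\<i> * of_int k * complex_of_real \<theta>) * P \<theta> =
        (\<Sum>j\<in>{- int r..int r}. (b * c j) * exp (\<i> * of_int (j + k) * complex_of_real \<theta>))"
      unfolding P trig_poly_def sum_distrib_left e by (simp only: mult_ac)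
    also have "\<dots> = (\<Sum>j\<in>{k - int r..k + int r}. (b * c (j - k)) * exp (\<i> * of_int j * complex_of_real \<theta>))"
      by (rule sum.reindex_bij_witness[of _ "\<lambda>j. j - k" "\<lambda>j. j + k"]) auto
    also have "\<dots> = trig_poly (r + nat \<bar>k\<bar>) c' \<theta>"
      unfolding trig_poly_def by (rule sum.mono_neutral_cong_left) (auto simp: c'_def)
    finally show ?thesis .
  qed
  then show ?thesis unfolding is_trig_poly_def by blast
qed

lemma is_trig_poly_const: "is_trig_poly (\<lambda>\<theta>. b)"
  unfolding is_trig_poly_def by (intro exI[of _ 0] exI[of _ "\<lambda>_. b"]) (simp add: trig_poly_def fun_eq_iff)

lemma is_trig_poly_sum:
  assumes "\<And>i. i \<in> I \<Longrightarrow> is_trig_poly (P i)"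
  shows "is_trig_poly (\<lambda>\<theta>. \<Sum>i\<in>I. P i \<theta>)"
  using assms
  by (induction I rule: infinite_finite_induct) (auto intro: is_trig_poly_add is_trig_poly_const)

lemma is_trig_poly_mult:
  assumes "is_trig_poly P" "is_trig_poly Q"
  shows "is_trig_poly (\<lambda>\<theta>. P \<theta> * Q \<theta>)"
proof -
  obtain r c where P: "P = trig_poly r c" using assms unfolding is_trig_poly_def by blast
  show ?thesis unfolding P trig_poly_def sum_distrib_right
    by (intro is_trig_poly_sum is_trig_poly_mult_exp assms)
qed

lemma is_trig_poly_polynomial_cis:
  assumes "real_polynomial_function q"
  shows "is_trig_poly (\<lambda>\<theta>. complex_of_real (q (cis \<theta>)))"
  using assms
proof (induction q rule: real_polynomial_function.induct)
  case (linear h)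
  note h_eq = bounded_linear_complex_expand[OF linear]
  have "complex_of_real (h (cis \<theta>)) =
      (h 1 / 2 - \<i> * h \<i> / 2) * exp (\<i> * of_int 1 * complex_of_real \<theta>) * 1 +
      (h 1 / 2 + \<i> * h \<i> / 2) * exp (\<i> * of_int (- 1) * complex_of_real \<theta>) * 1" for \<theta>
  proof -
    have "exp (\<i> * of_int 1 * complex_of_real \<theta>) = cis \<theta>" "exp (\<i> * of_int (- 1) * complex_of_real \<theta>) = cis (- \<theta>)"
      by (simp_all add: cis_conv_exp)
    then show ?thesis by (subst h_eq) (simp add: complex_eq_iff algebra_simps)
  qed
  then show ?case
    by (simp only:) (intro is_trig_poly_add is_trig_poly_mult_exp is_trig_poly_const)
qed (auto intro: is_trig_poly_add is_trig_poly_mult is_trig_poly_const)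

text \<open>Equal end values let \<open>h\<close> descend to a function H on the circle, and a
  polynomial on the circle becomes trigonometric after composition with \<open>cis\<close>.\<close>

lemma trig_weierstrass:
  fixes h :: "real \<Rightarrow> complex"
  assumes h: "continuous_on {-pi..pi} h" "h (- pi) = h pi" and e: "0 < e"
  obtains P where "is_trig_poly P" "\<And>\<theta>. \<theta> \<in> {-pi..pi} \<Longrightarrow> cmod (h \<theta> - P \<theta>) < e"
proof -
  have cis_image: "cis ` {-pi..pi} = sphere 0 1"
  proof
    show "sphere 0 1 \<subseteq> cis ` {-pi..pi}"
    proof
      fix z :: complex assume "z \<in> sphere 0 1"
      then have "z = cis (Arg z)" using cis_Arg[of z] by (force simp: sgn_div_norm)
      moreover have "Arg z \<in> {-pi..pi}" using Arg_bounded[of z] by auto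
      ultimately show "z \<in> cis ` {-pi..pi}" by blast
    qed
  qed auto
  define H where "H z = h (Arg z)" for z
  have H: "H (cis \<theta>) = h \<theta>" if "\<theta> \<in> {-pi..pi}" for \<theta>
  proof (cases "\<theta> = - pi")
    case True
    have "Arg (cis pi) = pi" by (intro cis_Arg_unique) auto
    moreover have "cis (- pi) = - 1" by (simp add: complex_eq_iff)
    ultimately show ?thesis using True h(2) by (simp add: H_def)
  next
    case False
    then have "Arg (cis \<theta>) = \<theta>" using that by (intro cis_Arg_unique) auto
    then show ?thesis by (simp add: H_def)
  qed
  \<comment> \<open>\<open>Arg\<close> jumps at -1, so continuity of H is not read off from its
    formula. A continuous surjection from a compact space to a Hausdorff one is a quotient map, and
    H composed with \<open>cis\<close> is \<open>h\<close>.\<close>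
  have quot: "quotient_map (top_of_set {-pi..pi}) (top_of_set (sphere 0 1)) cis"
    by (rule continuous_imp_quotient_map)
       (auto simp: cis_image compact_space_subtopology Hausdorff_space_subtopology Hausdorff_space_euclidean
         intro!: continuous_intros)
  have "continuous_on {-pi..pi} (H \<circ> cis)"
    by (rule continuous_on_eq[OF h(1)]) (simp add: H)
  then have "continuous_map (top_of_set {-pi..pi}) euclidean (H \<circ> cis)" by simp
  from continuous_compose_quotient_map[OF quot this] have "continuous_on (sphere 0 1) H" by simp
  then obtain g where g: "polynomial_function g" "\<And>z. z \<in> sphere 0 1 \<Longrightarrow> norm (H z - g z) < e"
    using Stone_Weierstrass_polynomial_function[OF compact_sphere _ e] by metis
  define P where "P \<theta> = complex_of_real (Re (g (cis \<theta>))) + \<i> * complex_of_real (Im (g (cis \<theta>)))" for \<theta>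
  have P: "P \<theta> = g (cis \<theta>)" for \<theta> by (simp add: P_def complex_eq_iff)
  have "is_trig_poly P" unfolding P_def
    by (intro is_trig_poly_add is_trig_poly_mult is_trig_poly_const is_trig_poly_polynomial_cis
        polynomial_function_Re_Im g)
  moreover have "cmod (h \<theta> - P \<theta>) < e" if "\<theta> \<in> {-pi..pi}" for \<theta>
    using g(2)[of "cis \<theta>"] H[OF that] by (simp add: P)
  ultimately show ?thesis using that by blast
qed

section \<open>Almost everywhere approximation, density in the mean, uniqueness of
  coefficients\<close>

lemma AE_circ_not_in:
  assumes "negligible N"
  shows "AE \<theta> in circ. \<theta> \<notin> N"
proof -
  have "AE \<theta> in lebesgue. \<theta> \<notin> N"
    using assms by (intro AE_not_in) (simp add: negligible_iff_null_sets)
  then show ?thesis unfolding circ_def by (subst AE_restrict_space_iff) auto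
qed

text \<open>Pointwise limits with a uniform bound, made for dominated convergence; both density in
  the mean and uniqueness rest on it. The bound 2 is 1 for the clipped function plus an
  approximation error of at most 1.\<close>

lemma bounded_approx_trig_poly:
  assumes u: "u \<in> borel_measurable circ" and u_le: "\<And>\<theta>. \<theta> \<in> {-pi..pi} \<Longrightarrow> cmod (u \<theta>) \<le> 1"
  obtains P where "\<And>n. is_trig_poly (P n)" "\<And>n \<theta>. \<theta> \<in> {-pi..pi} \<Longrightarrow> cmod (P n \<theta>) \<le> 2"
    "AE \<theta> in circ. (\<lambda>n. P n \<theta>) \<longlonglongrightarrow> u \<theta>"
proof -
  define v where "v \<theta> = (if \<theta> \<in> {-pi..pi} then u \<theta> else 0)" for \<theta>
  have "v \<in> borel_measurable lebesgue"
    using u unfolding v_def circ_def by (rule borel_measurable_if_I) simp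
  then have "v measurable_on UNIV" by (intro lebesgue_measurable_imp_measurable_on) auto
  then obtain N g where N: "negligible N" and g: "\<And>n. continuous_on UNIV (g n)"
    and lim: "\<And>x. x \<notin> N \<Longrightarrow> (\<lambda>n. g n x) \<longlonglongrightarrow> v x"
    unfolding measurable_on_def by auto
  \<comment> \<open>The first factor clips g to the unit disc. The second vanishes at both ends,
    which gives equal end values, and tends to 1 at every interior point.\<close>
  define h where "h n \<theta> = g n \<theta> / max 1 (cmod (g n \<theta>)) * min 1 (real n * (pi - \<bar>\<theta>\<bar>))" for n \<theta>
  have h_cont: "continuous_on {-pi..pi} (h n)" for n
    unfolding h_def by (intro continuous_intros continuous_on_subset[OF g]) auto
  have h_ends: "h n (- pi) = h n pi" for n by (simp add: h_def)
  have h_le: "cmod (h n \<theta>) \<le> 1" if "\<theta> \<in> {-pi..pi}" for n \<theta>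
  proof -
    have "\<bar>min 1 (real n * (pi - \<bar>\<theta>\<bar>))\<bar> \<le> 1" using that by auto
    moreover have "cmod (g n \<theta> / max 1 (cmod (g n \<theta>))) \<le> 1" by (simp add: norm_divide divide_simps)
    ultimately show ?thesis unfolding h_def norm_mult norm_of_real by (intro mult_le_one) auto
  qed
  have "\<exists>P. is_trig_poly P \<and> (\<forall>\<theta>\<in>{-pi..pi}. cmod (h n \<theta> - P \<theta>) < 1 / Suc n)" for n
    by (rule trig_weierstrass[OF h_cont h_ends, of "1 / Suc n" n]) auto
  then obtain P where P: "\<And>n. is_trig_poly (P n)" "\<And>n \<theta>. \<theta> \<in> {-pi..pi} \<Longrightarrow> cmod (h n \<theta> - P n \<theta>) < 1 / Suc n"
    by metis
  have "cmod (P n \<theta>) \<le> 2" if "\<theta> \<in> {-pi..pi}" for n \<theta>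
  proof -
    have "cmod (h n \<theta> - P n \<theta>) < 1" by (rule less_le_trans[OF P(2)[OF that]]) simp
    then show ?thesis
      using h_le[OF that, of n] norm_triangle_ineq4[of "h n \<theta>" "h n \<theta> - P n \<theta>"] by simp
  qed
  moreover have "AE \<theta> in circ. (\<lambda>n. P n \<theta>) \<longlonglongrightarrow> u \<theta>"
  proof -
    have "negligible (N \<union> {-pi, pi})" by (rule negligible_Un[OF N]) (simp add: negligible_finite)
    from AE_circ_not_in[OF this] AE_space[of circ] show ?thesis
    proof eventually_elim
      case (elim \<theta>)
      then have \<theta>: "\<theta> \<in> {-pi..pi}" "\<bar>\<theta>\<bar> < pi" "\<theta> \<notin> N" by auto
      have g_lim: "(\<lambda>n. g n \<theta>) \<longlonglongrightarrow> u \<theta>" using lim[OF \<theta>(3)] \<theta>(1) by (simp add: v_def)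
      have "(\<lambda>n. g n \<theta> / max 1 (cmod (g n \<theta>))) \<longlonglongrightarrow> u \<theta> / max 1 (cmod (u \<theta>))"
        by (intro tendsto_intros g_lim) auto
      moreover have "filterlim (\<lambda>n. real n * (pi - \<bar>\<theta>\<bar>)) at_top sequentially"
        using \<theta>(2) by (intro filterlim_tendsto_pos_mult_at_top[OF tendsto_const] filterlim_at_top_mult_tendsto_pos[OF tendsto_const] filterlim_real_sequentially) auto
      then have "\<forall>\<^sub>F n in sequentially. 1 \<le> real n * (pi - \<bar>\<theta>\<bar>)" by (simp add: filterlim_at_top)
      then have "\<forall>\<^sub>F n in sequentially. complex_of_real (min 1 (real n * (pi - \<bar>\<theta>\<bar>))) = 1"
        by eventually_elim simp
      then have "(\<lambda>n. complex_of_real (min 1 (real n * (pi - \<bar>\<theta>\<bar>)))) \<longlonglongrightarrow> 1" by (rule tendsto_eventually)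
      ultimately have "(\<lambda>n. h n \<theta>) \<longlonglongrightarrow> u \<theta> / max 1 (cmod (u \<theta>)) * 1"
        unfolding h_def by (rule tendsto_mult)
      moreover have "max 1 (cmod (u \<theta>)) = 1" using u_le[OF \<theta>(1)] by simp
      ultimately have "(\<lambda>n. h n \<theta>) \<longlonglongrightarrow> u \<theta>" by simp
      moreover have "(\<lambda>n. h n \<theta> - P n \<theta>) \<longlonglongrightarrow> 0"
        by (rule Lim_null_comparison[OF _ LIMSEQ_Suc[OF lim_1_over_n]])
           (use P(2)[OF \<theta>(1)] in \<open>auto intro!: always_eventually less_imp_le\<close>)
      ultimately have "(\<lambda>n. h n \<theta> - (h n \<theta> - P n \<theta>)) \<longlonglongrightarrow> u \<theta> - 0" by (rule tendsto_diff)
      then show ?case by simp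
    qed
  qed
  ultimately show ?thesis using that P(1) by blast
qed

lemma borel_measurable_of_real_cnj [measurable]:
  "complex_of_real \<in> borel_measurable borel" "cnj \<in> borel_measurable borel"
  by (intro borel_measurable_continuous_onI continuous_intros)+

lemma is_trig_poly_continuous: "is_trig_poly P \<Longrightarrow> continuous_on S P"
  unfolding is_trig_poly_def using continuous_on_trig_poly by blast

lemma is_trig_poly_measurable: "is_trig_poly P \<Longrightarrow> P \<in> borel_measurable circ"
  by (intro continuous_borel_measurable_circ is_trig_poly_continuous)

text \<open>Two dominated convergences: first f is truncated radially at a large height, then the
  truncated function is approximated by bounded polynomials.\<close>

lemma trig_poly_L1_dense:
  assumes f: "integrable circ f" and e: "0 < e"
  obtains P where "is_trig_poly P" "(LINT \<theta>|circ. cmod (f \<theta> - P \<theta>)) < e"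
proof -
  have [measurable]: "f \<in> borel_measurable circ" using f by auto
  have e2: "0 < e / 2" using e by simp
  \<comment> \<open>\<open>Suc n * u n\<close> is f with its modulus cut off at n + 1; dividing by
    the height puts \<open>u n\<close> into the unit disc.\<close>
  define u where "u n \<theta> = f \<theta> / max (real (Suc n)) (cmod (f \<theta>))" for n \<theta>
  have [measurable]: "u n \<in> borel_measurable circ" for n unfolding u_def by measurable
  have u_le: "cmod (u n \<theta>) \<le> 1" for n \<theta> by (simp add: u_def norm_divide divide_simps)
  have "(\<lambda>n. LINT \<theta>|circ. cmod (f \<theta> - Suc n * u n \<theta>)) \<longlonglongrightarrow> (LINT \<theta>|circ. 0)"
  proof (rule integral_dominated_convergence)
    show "integrable circ (\<lambda>\<theta>. 2 * cmod (f \<theta>))" using f by simp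
    show "AE \<theta> in circ. (\<lambda>n. cmod (f \<theta> - Suc n * u n \<theta>)) \<longlonglongrightarrow> 0"
    proof (intro AE_I2 tendsto_eventually)
      fix \<theta>
      have "\<forall>\<^sub>F n in sequentially. cmod (f \<theta>) \<le> real (Suc n)"
        using eventually_ge_at_top[of "nat \<lceil>cmod (f \<theta>)\<rceil>"] by eventually_elim linarith
      then show "\<forall>\<^sub>F n in sequentially. cmod (f \<theta> - Suc n * u n \<theta>) = 0"
      proof eventually_elim
        case (elim n)
        then have "max (real (Suc n)) (cmod (f \<theta>)) = Suc n" by simp
        then show ?case unfolding u_def by (simp del: of_nat_Suc)
      qed
    qed
    fix n
    have "cmod (Suc n * u n \<theta>) \<le> cmod (f \<theta>)" for \<theta>
    proof -
      have "real (Suc n) / max (real (Suc n)) (cmod (f \<theta>)) \<le> 1" by (simp add: divide_simps)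
      from mult_right_mono[OF this norm_ge_zero[of "f \<theta>"]] show ?thesis
        by (simp add: u_def norm_mult norm_divide del: of_nat_Suc)
    qed
    then have "cmod (f \<theta> - Suc n * u n \<theta>) \<le> 2 * cmod (f \<theta>)" for \<theta>
      using norm_triangle_ineq4[of "f \<theta>" "Suc n * u n \<theta>"] by (smt (verit))
    then show "AE \<theta> in circ. norm (cmod (f \<theta> - Suc n * u n \<theta>)) \<le> 2 * cmod (f \<theta>)"
      by (intro AE_I2) (simp only: real_norm_def abs_norm_cancel)
  qed auto
  then have "(\<lambda>n. LINT \<theta>|circ. cmod (f \<theta> - Suc n * u n \<theta>)) \<longlonglongrightarrow> 0" by simp
  from eventually_happens'[OF sequentially_bot order_tendstoD(2)[OF this e2]] obtain m where m: "(LINT \<theta>|circ. cmod (f \<theta> - Suc m * u m \<theta>)) < e / 2"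
    by blast
  obtain P where P: "\<And>n. is_trig_poly (P n)" "\<And>n \<theta>. \<theta> \<in> {-pi..pi} \<Longrightarrow> cmod (P n \<theta>) \<le> 2"
    "AE \<theta> in circ. (\<lambda>n. P n \<theta>) \<longlonglongrightarrow> u m \<theta>"
    by (rule bounded_approx_trig_poly[of "u m"]) (use u_le in auto)
  have [measurable]: "P n \<in> borel_measurable circ" for n by (rule is_trig_poly_measurable[OF P(1)])
  have "(\<lambda>n. LINT \<theta>|circ. cmod (Suc m * u m \<theta> - Suc m * P n \<theta>)) \<longlonglongrightarrow> (LINT \<theta>|circ. 0)"
  proof (rule integral_dominated_convergence)
    show "integrable circ (\<lambda>\<theta>. real (Suc m) * 3)" by simp
    show "AE \<theta> in circ. (\<lambda>n. cmod (Suc m * u m \<theta> - Suc m * P n \<theta>)) \<longlonglongrightarrow> 0"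
      using P(3)
    proof eventually_elim
      case (elim \<theta>)
      have "(\<lambda>n. cmod (Suc m * u m \<theta> - Suc m * P n \<theta>)) \<longlonglongrightarrow> cmod (Suc m * u m \<theta> - Suc m * u m \<theta>)"
        by (intro tendsto_intros elim)
      then show ?case by simp
    qed
    fix n
    have "cmod (Suc m * u m \<theta> - Suc m * P n \<theta>) \<le> real (Suc m) * 3" if "\<theta> \<in> {-pi..pi}" for \<theta>
    proof -
      have "cmod (u m \<theta> - P n \<theta>) \<le> 3"
        using u_le[of m \<theta>] P(2)[OF that, of n] norm_triangle_ineq4[of "u m \<theta>" "P n \<theta>"] by linarith
      then have "real (Suc m) * cmod (u m \<theta> - P n \<theta>) \<le> real (Suc m) * 3" by (intro mult_left_mono) auto
      then show ?thesis by (simp add: norm_mult flip: right_diff_distrib del: of_nat_Suc)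
    qed
    then show "AE \<theta> in circ. norm (cmod (Suc m * u m \<theta> - Suc m * P n \<theta>)) \<le> real (Suc m) * 3"
      by (intro AE_I2) auto
  qed auto
  then have "(\<lambda>n. LINT \<theta>|circ. cmod (Suc m * u m \<theta> - Suc m * P n \<theta>)) \<longlonglongrightarrow> 0" by simp
  from eventually_happens'[OF sequentially_bot order_tendstoD(2)[OF this e2]] obtain n where n: "(LINT \<theta>|circ. cmod (Suc m * u m \<theta> - Suc m * P n \<theta>)) < e / 2"
    by blast
  define Q where "Q \<theta> = Suc m * P n \<theta>" for \<theta>
  have Q: "is_trig_poly Q" unfolding Q_def by (intro is_trig_poly_mult is_trig_poly_const P)
  have iQ: "integrable circ Q" by (intro integrable_circ_continuous is_trig_poly_continuous Q)
  have iu: "integrable circ (\<lambda>\<theta>. Suc m * u m \<theta>)"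
    by (rule integrable_circ_mult_bounded[of "\<lambda>_. Suc m", OF circ.integrable_const]) (use u_le in auto)
  have "(LINT \<theta>|circ. cmod (f \<theta> - Q \<theta>)) \<le> (LINT \<theta>|circ. cmod (f \<theta> - Suc m * u m \<theta>) + cmod (Suc m * u m \<theta> - Q \<theta>))"
  proof (rule integral_mono)
    show "cmod (f \<theta> - Q \<theta>) \<le> cmod (f \<theta> - Suc m * u m \<theta>) + cmod (Suc m * u m \<theta> - Q \<theta>)" for \<theta>
      using norm_triangle_ineq[of "f \<theta> - Suc m * u m \<theta>" "Suc m * u m \<theta> - Q \<theta>"] by simp
  qed (use f iu iQ in auto)
  also have "\<dots> = (LINT \<theta>|circ. cmod (f \<theta> - Suc m * u m \<theta>)) + (LINT \<theta>|circ. cmod (Suc m * u m \<theta> - Q \<theta>))"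
    using f iu iQ by (intro Bochner_Integration.integral_add) auto
  also have "\<dots> < e" using m n by (simp add: Q_def)
  finally show ?thesis using that Q by blast
qed

text \<open>Vanishing coefficients make d orthogonal to all trigonometric polynomials. Boundedly
  approximating the conjugate phase of d by such polynomials gives that the integral of |d| is
  0.\<close>

lemma fourier_uniqueness:
  assumes d: "integrable circ d" and coeff: "\<And>k. fourier_coeff d k = 0"
  shows "AE \<theta> in circ. d \<theta> = 0"
proof -
  have [measurable]: "d \<in> borel_measurable circ" using d by auto
  \<comment> \<open>Where d is 0 the quotient is 0, so \<open>u\<close> has modulus at most 1
    everywhere and u d = |d|.\<close>
  define u where "u \<theta> = cnj (d \<theta>) / cmod (d \<theta>)" for \<theta>
  have [measurable]: "u \<in> borel_measurable circ" unfolding u_def by measurable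
  obtain P where P: "\<And>n. is_trig_poly (P n)" "\<And>n \<theta>. \<theta> \<in> {-pi..pi} \<Longrightarrow> cmod (P n \<theta>) \<le> 2"
    "AE \<theta> in circ. (\<lambda>n. P n \<theta>) \<longlonglongrightarrow> u \<theta>"
    by (rule bounded_approx_trig_poly[of u]) (auto simp: u_def norm_divide)
  have [measurable]: "P n \<in> borel_measurable circ" for n by (rule is_trig_poly_measurable[OF P(1)])
  have "(LINT \<theta>|circ. P n \<theta> * d \<theta>) = 0" for n
  proof -
    obtain r c where Pn: "P n = trig_poly r c" using P(1)[of n] unfolding is_trig_poly_def by blast
    have "fourier_coeff (\<lambda>\<theta>. P n \<theta> * d \<theta>) 0 = 0"
      unfolding Pn by (simp add: fourier_coeff_trig_poly_mult[OF d] coeff)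
    then show ?thesis by (simp add: fourier_coeff_circ)
  qed
  moreover have "(\<lambda>n. LINT \<theta>|circ. P n \<theta> * d \<theta>) \<longlonglongrightarrow> (LINT \<theta>|circ. complex_of_real (cmod (d \<theta>)))"
  proof (rule integral_dominated_convergence)
    show "integrable circ (\<lambda>\<theta>. 2 * cmod (d \<theta>))" using d by simp
    show "AE \<theta> in circ. (\<lambda>n. P n \<theta> * d \<theta>) \<longlonglongrightarrow> complex_of_real (cmod (d \<theta>))"
      using P(3)
    proof eventually_elim
      case (elim \<theta>)
      have "(\<lambda>n. P n \<theta> * d \<theta>) \<longlonglongrightarrow> u \<theta> * d \<theta>" by (intro tendsto_intros elim)
      also have "u \<theta> * d \<theta> = complex_of_real (cmod (d \<theta>))"
        using complex_norm_square[of "d \<theta>"]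
        by (cases "d \<theta> = 0") (simp_all add: u_def field_simps power2_eq_square)
      finally show ?case .
    qed
    show "AE \<theta> in circ. norm (P n \<theta> * d \<theta>) \<le> 2 * cmod (d \<theta>)" for n
      using P(2) by (intro AE_I2) (auto simp: norm_mult intro!: mult_right_mono)
  qed auto
  ultimately have "(LINT \<theta>|circ. complex_of_real (cmod (d \<theta>))) = 0"
    by (simp add: LIMSEQ_const_iff)
  then have "(LINT \<theta>|circ. cmod (d \<theta>)) = 0" by simp
  then have "AE \<theta> in circ. cmod (d \<theta>) = 0"
    using d by (subst (asm) integral_nonneg_eq_0_iff_AE) auto
  then show ?thesis by simp
qed

subsection \<open>Integrable symbols\<close>

lemma integral_circ_reflect:
  fixes g :: "real \<Rightarrow> 'a :: euclidean_space"
  shows "(LINT \<theta>|circ. g (- \<theta>)) = (LINT \<theta>|circ. g \<theta>)"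
    and "integrable circ (\<lambda>\<theta>. g (- \<theta>)) \<longleftrightarrow> integrable circ g"
proof -
  let ?h = "\<lambda>\<theta>. indicator {-pi..pi} \<theta> *\<^sub>R g \<theta>"
  have ind: "indicator {-pi..pi} (- \<theta>) = (indicator {-pi..pi} \<theta> :: real)" for \<theta>
    by (auto simp: indicator_def)
  show "(LINT \<theta>|circ. g (- \<theta>)) = (LINT \<theta>|circ. g \<theta>)"
    using lebesgue_integral_real_affine[of "-1" ?h 0] by (simp add: circ_def integral_restrict_space ind)
  show "integrable circ (\<lambda>\<theta>. g (- \<theta>)) \<longleftrightarrow> integrable circ g"
    using lebesgue_integrable_real_affine_iff[of "-1" ?h 0] by (simp add: circ_def integrable_restrict_space ind)
qed

lemma fourier_coeff_cnj_reflect: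
  "fourier_coeff (\<lambda>\<theta>. cnj (f (- \<theta>))) k = cnj (fourier_coeff f k)"
proof -
  have "(LINT \<theta>|circ. cnj (f (- \<theta>)) * exp (- (\<i> * of_int k * complex_of_real \<theta>)))
      = (LINT \<theta>|circ. cnj (f \<theta> * exp (- (\<i> * of_int k * complex_of_real \<theta>))))"
    by (subst integral_circ_reflect(1)[symmetric]) (simp add: exp_cnj)
  also have "\<dots> = cnj (LINT \<theta>|circ. f \<theta> * exp (- (\<i> * of_int k * complex_of_real \<theta>)))"
    by (rule Bochner_Integration.integral_cnj)
  finally show ?thesis by (simp add: fourier_coeff_circ)
qed

text \<open>Real Fourier coefficients mean that \<open>f\<close> and \<open>cnj (f (- \<theta>))\<close> agree almost everywhere, so
  symmetrizing an approximant does not increase its distance to \<open>f\<close>.\<close>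

lemma real_trig_poly_L1_dense:
  assumes f: "integrable circ f" and f_real: "\<And>k. fourier_coeff f k \<in> \<real>" and e: "0 < e"
  obtains r c where "\<And>j. c j \<in> \<real>" "(LINT \<theta>|circ. cmod (f \<theta> - trig_poly r c \<theta>)) < e"
proof -
  define f' where "f' \<theta> = cnj (f (- \<theta>))" for \<theta>
  have f': "integrable circ f'"
    unfolding f'_def using f integral_circ_reflect(2)[of f] by (intro integrable_cnj) simp
  have "AE \<theta> in circ. f \<theta> - f' \<theta> = 0"
  proof (rule fourier_uniqueness)
    show "integrable circ (\<lambda>\<theta>. f \<theta> - f' \<theta>)" using f f' by simp
    show "fourier_coeff (\<lambda>\<theta>. f \<theta> - f' \<theta>) k = 0" for k
      using f_real[of k] unfolding fourier_coeff_diff[OF f f'] unfolding f'_def fourier_coeff_cnj_reflect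
      by (simp add: Reals_cnj_iff)
  qed
  then have AE_eq: "AE \<theta> in circ. f' \<theta> = f \<theta>" by eventually_elim simp
  obtain r c where P: "(LINT \<theta>|circ. cmod (f \<theta> - trig_poly r c \<theta>)) < e"
    using trig_poly_L1_dense[OF f e] unfolding is_trig_poly_def by metis
  let ?P = "trig_poly r c" and ?P' = "\<lambda>\<theta>. cnj (trig_poly r c (- \<theta>))"
  \<comment> \<open>Taking real parts of the coefficients is the same as averaging \<open>?P\<close>
    with its reflected conjugate \<open>?P'\<close>.\<close>
  let ?Q = "trig_poly r (\<lambda>j. complex_of_real (Re (c j)))"
  have iP: "integrable circ ?P" by (intro integrable_circ_continuous continuous_on_trig_poly)
  have iP': "integrable circ ?P'" using iP integral_circ_reflect(2)[of ?P] by (intro integrable_cnj) simp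
  have iQ: "integrable circ ?Q" by (intro integrable_circ_continuous continuous_on_trig_poly)
  have Q: "?Q \<theta> = (?P \<theta> + ?P' \<theta>) / 2" for \<theta>
  proof -
    have "?P \<theta> + ?P' \<theta> = (\<Sum>j\<in>{- int r..int r}. (c j + cnj (c j)) * exp (\<i> * of_int j * complex_of_real \<theta>))"
      by (simp add: trig_poly_def exp_cnj sum.distrib distrib_right)
    also have "\<dots> = 2 * ?Q \<theta>"
      by (simp add: trig_poly_def complex_add_cnj sum_distrib_left mult.assoc)
    finally show ?thesis by simp
  qed
  have "(LINT \<theta>|circ. cmod (f \<theta> - ?P' \<theta>)) = (LINT \<theta>|circ. cmod (f' \<theta> - ?P' \<theta>))"
    using AE_eq f f' iP' by (intro integral_cong_AE) auto
  also have "\<dots> = (LINT \<theta>|circ. cmod (f (- \<theta>) - ?P (- \<theta>)))"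
    unfolding f'_def complex_cnj_diff[symmetric] complex_mod_cnj ..
  also have "\<dots> = (LINT \<theta>|circ. cmod (f \<theta> - ?P \<theta>))"
    by (rule integral_circ_reflect(1))
  finally have P': "(LINT \<theta>|circ. cmod (f \<theta> - ?P' \<theta>)) < e" using P by simp
  have "(LINT \<theta>|circ. cmod (f \<theta> - ?Q \<theta>)) \<le> (LINT \<theta>|circ. cmod (f \<theta> - ?P \<theta>) / 2 + cmod (f \<theta> - ?P' \<theta>) / 2)"
  proof (rule integral_mono)
    fix \<theta>
    have "f \<theta> - ?Q \<theta> = (f \<theta> - ?P \<theta>) / 2 + (f \<theta> - ?P' \<theta>) / 2"
      unfolding Q by (simp add: field_simps)
    then show "cmod (f \<theta> - ?Q \<theta>) \<le> cmod (f \<theta> - ?P \<theta>) / 2 + cmod (f \<theta> - ?P' \<theta>) / 2"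
      using norm_triangle_ineq[of "(f \<theta> - ?P \<theta>) / 2" "(f \<theta> - ?P' \<theta>) / 2"] by (simp add: norm_divide)
  qed (use f iP iP' iQ in auto)
  also have "\<dots> = (LINT \<theta>|circ. cmod (f \<theta> - ?P \<theta>)) / 2 + (LINT \<theta>|circ. cmod (f \<theta> - ?P' \<theta>)) / 2"
    using f iP iP' by simp
  also have "\<dots> < e" using P P' by simp
  finally show ?thesis using that[of "\<lambda>j. complex_of_real (Re (c j))" r] by simp
qed

lemma ev_mean_separable:
  assumes F: "separable r C F" and f: "integrable circ f" and f_real: "\<And>k. fourier_coeff f k \<in> \<real>"
  shows "(\<lambda>n. ev_mean f n F) \<longlonglongrightarrow> limit_mean f F"
proof (rule LIMSEQ_I)
  fix e :: real assume e: "0 < e"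
  \<comment> \<open>Adding 1 keeps \<open>K\<close> positive when r or C is 0, so that e / (3 * K)
    is a legitimate accuracy.\<close>
  define K where "K = r * C\<^sup>2 / (2 * pi) + 1"
  have K: "0 < K" unfolding K_def by (intro add_nonneg_pos divide_nonneg_pos) auto
  have e3K: "0 < e / (3 * K)" using e K by simp
  obtain R c where c: "\<And>j. c j \<in> \<real>" and fp: "(LINT \<theta>|circ. cmod (f \<theta> - trig_poly R c \<theta>)) < e / (3 * K)"
    by (rule real_trig_poly_L1_dense[OF f f_real e3K]) (rule that)
  let ?p = "trig_poly R c"
  have p: "integrable circ ?p" by (intro integrable_circ_continuous continuous_on_trig_poly)
  have p_real: "fourier_coeff ?p k \<in> \<real>" for k by (rule fourier_coeff_trig_poly_real[OF c])
  have "r * C\<^sup>2 * (LINT \<theta>|circ. cmod (f \<theta> - ?p \<theta>)) / (2 * pi) = (K - 1) * (LINT \<theta>|circ. cmod (f \<theta> - ?p \<theta>))"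
    by (simp add: K_def)
  also have "\<dots> \<le> K * (LINT \<theta>|circ. cmod (f \<theta> - ?p \<theta>))" by (intro mult_right_mono) auto
  also have "\<dots> < K * (e / (3 * K))" using fp K by (intro mult_strict_left_mono)
  also have "\<dots> = e / 3" using K by simp
  finally have le: "r * C\<^sup>2 * (LINT \<theta>|circ. cmod (f \<theta> - ?p \<theta>)) / (2 * pi) < e / 3" .
  have 1: "cmod (ev_mean f n F - ev_mean ?p n F) < e / 3" for n
    by (rule le_less_trans[OF ev_mean_perturbation[OF F f p f_real p_real] le])
  have 2: "cmod (limit_mean f F - limit_mean ?p F) < e / 3"
    by (rule le_less_trans[OF limit_mean_perturbation[OF F f p] le])
  have e3: "0 < e / 3" using e by simp
  obtain N where N: "\<And>n. n \<ge> N \<Longrightarrow> cmod (ev_mean ?p n F - limit_mean ?p F) < e / 3"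
    using LIMSEQ_D[OF ev_mean_trig_poly[where r = R and c = c, OF c separable_continuous[OF F]] e3] by blast
  show "\<exists>N. \<forall>n\<ge>N. cmod (ev_mean f n F - limit_mean f F) < e"
  proof (intro exI allI impI)
    fix n assume "n \<ge> N"
    show "cmod (ev_mean f n F - limit_mean f F) < e"
      using norm_diff_triangle3[of "ev_mean f n F" "limit_mean f F" "ev_mean ?p n F" "limit_mean ?p F"]
        1[of n] 2 N[OF \<open>n \<ge> N\<close>] by linarith
  qed
qed

section \<open>Test functions of bounded support and the doubled domain\<close>

lemma integrable_circ_bounded_continuous:
  assumes h: "h \<in> borel_measurable circ" and F: "continuous_on UNIV F" and B: "\<And>z. cmod (F z) \<le> B"
  shows "integrable circ (\<lambda>\<theta>. F (h \<theta>))"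
proof (rule circ.integrable_const_bound)
  show "AE \<theta> in circ. cmod (F (h \<theta>)) \<le> B" using B by simp
  show "(\<lambda>\<theta>. F (h \<theta>)) \<in> borel_measurable circ"
    by (rule measurable_compose[OF h borel_measurable_continuous_onI[OF F]])
qed

lemma bounded_support_bounded:
  fixes F :: "complex \<Rightarrow> complex"
  assumes F: "continuous_on UNIV F" and supp: "bounded {z. F z \<noteq> 0}"
  obtains B where "\<And>z. cmod (F z) \<le> B"
proof -
  have "compact (F ` closure {z. F z \<noteq> 0})"
    using supp by (intro compact_continuous_image continuous_on_subset[OF F]) auto
  from compact_imp_bounded[OF this] obtain B where "\<forall>w\<in>F ` closure {z. F z \<noteq> 0}. cmod w \<le> B"
    unfolding bounded_iff by blast
  then have B: "\<And>w. w \<in> F ` closure {z. F z \<noteq> 0} \<Longrightarrow> cmod w \<le> B" by blast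
  have "cmod (F z) \<le> max B 0" for z
    using B[of "F z"] closure_subset[of "{z. F z \<noteq> 0}"] by (cases "F z = 0") (auto intro: max.coboundedI1)
  then show ?thesis by (rule that)
qed

text \<open>No interval is known to hold the spectra for all n, so the approximation must be uniform
  on the whole real line; \<open>bounded_separable_dense\<close> provides exactly that.\<close>

lemma ev_mean_limit:
  assumes f: "integrable circ f" and f_real: "\<And>k. fourier_coeff f k \<in> \<real>"
    and F: "continuous_on UNIV F" and supp: "bounded {z. F z \<noteq> 0}"
  shows "(\<lambda>n. ev_mean f n (\<lambda>x. F (complex_of_real x))) \<longlonglongrightarrow> limit_mean f (\<lambda>x. F (complex_of_real x))"
proof (rule ev_mean_limit_approx[OF f_real, where S = UNIV])
  obtain B where B: "\<And>z. cmod (F z) \<le> B" using bounded_support_bounded[OF F supp] by blast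
  have [measurable]: "f \<in> borel_measurable circ" using f by auto
  show "integrable circ (\<lambda>\<theta>. F (complex_of_real (cmod (f \<theta>))) + F (complex_of_real (- cmod (f \<theta>))))"
    by (intro Bochner_Integration.integrable_add integrable_circ_bounded_continuous[OF _ F B]) measurable
  fix e :: real assume "0 < e"
  then obtain G where G: "bounded_separable G" "\<And>x. cmod (F (complex_of_real x) - G x) < e"
    using bounded_separable_dense[OF F supp] by blast
  then obtain r C where sep: "separable r C G" unfolding bounded_separable_def by blast
  have "integrable circ (\<lambda>\<theta>. G (cmod (f \<theta>)) + G (- cmod (f \<theta>)))"
    using f by (intro Bochner_Integration.integrable_add separable_integrable[OF sep]) auto
  then show "\<exists>G. (\<forall>x\<in>UNIV. cmod (F (complex_of_real x) - G x) \<le> e) \<and>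
      integrable circ (\<lambda>\<theta>. G (cmod (f \<theta>)) + G (- cmod (f \<theta>))) \<and>
      (\<lambda>n. ev_mean f n G) \<longlonglongrightarrow> limit_mean f G"
    using G(2) ev_mean_separable[OF sep f f_real] by (intro exI[of _ G]) (auto intro: less_imp_le)
qed auto

text \<open>The coefficients live on [-pi, pi] but \<open>phi\<close> uses [0, 2 pi]. Translating
  [-pi, 0] by one period onto [pi, 2 pi] carries integrability and the integral over; the shared end
  points are null sets.\<close>

lemma periodic_set_integral:
  fixes h :: "real \<Rightarrow> complex"
  assumes h: "integrable circ h" and per: "\<And>\<theta>. h (\<theta> + 2 * pi) = h \<theta>"
  shows "set_integrable lebesgue {0..2*pi} h" "(LINT \<theta>:{0..2*pi}|lebesgue. h \<theta>) = (LINT \<theta>|circ. h \<theta>)"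
proof -
  have h_int: "set_integrable lebesgue {-pi..pi} h" using h by (simp add: integrable_circ_iff)
  have L: "set_integrable lebesgue {-pi..0} h" "set_integrable lebesgue {0..pi} h"
    by (rule set_integrable_subset[OF h_int]; auto)+
  have shift: "indicator {pi..2*pi} (2 * pi + 1 * \<theta>) *\<^sub>R h (2 * pi + 1 * \<theta>) = indicator {-pi..0} \<theta> *\<^sub>R h \<theta>" for \<theta>
    using per[of \<theta>] by (auto simp: indicator_def add.commute)
  have R: "set_integrable lebesgue {pi..2*pi} h"
    using L(1) lebesgue_integrable_real_affine_iff[of 1 "\<lambda>\<theta>. indicator {pi..2*pi} \<theta> *\<^sub>R h \<theta>" "2 * pi"]
    unfolding set_integrable_def shift by simp
  have R_eq: "(LINT \<theta>:{pi..2*pi}|lebesgue. h \<theta>) = (LINT \<theta>:{-pi..0}|lebesgue. h \<theta>)"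
    using lebesgue_integral_real_affine[of 1 "\<lambda>\<theta>. indicator {pi..2*pi} \<theta> *\<^sub>R h \<theta>" "2 * pi"]
    unfolding set_lebesgue_integral_def shift by simp
  have AE_neq: "AE \<theta> in lebesgue. \<theta> \<notin> {a}" for a :: real
    by (rule AE_not_in) (simp flip: negligible_iff_null_sets)
  have right: "{0..2*pi} = {0..pi} \<union> {pi..2*pi}" and left: "{-pi..pi} = {-pi..0} \<union> {0..pi}"
    using pi_gt_zero by (auto simp del: pi_gt_zero)
  show "set_integrable lebesgue {0..2*pi} h"
    unfolding right by (rule set_integrable_Un[OF L(2) R]) auto
  have "(LINT \<theta>:{0..2*pi}|lebesgue. h \<theta>) = (LINT \<theta>:{0..pi}|lebesgue. h \<theta>) + (LINT \<theta>:{pi..2*pi}|lebesgue. h \<theta>)"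
    unfolding right
    by (rule set_integral_Un_AE[OF _ _ _ L(2) R]) (use AE_neq[of pi] in \<open>auto elim!: eventually_mono\<close>)
  also have "\<dots> = (LINT \<theta>:{-pi..0}|lebesgue. h \<theta>) + (LINT \<theta>:{0..pi}|lebesgue. h \<theta>)"
    by (simp add: R_eq)
  also have "\<dots> = (LINT \<theta>:{-pi..pi}|lebesgue. h \<theta>)"
    unfolding left
    by (rule set_integral_Un_AE[OF _ _ _ L, symmetric]) (use AE_neq[of 0] in \<open>auto elim!: eventually_mono\<close>)
  also have "\<dots> = (LINT \<theta>|circ. h \<theta>)"
    by (simp add: circ_def set_lebesgue_integral_def integral_restrict_space)
  finally show "(LINT \<theta>:{0..2*pi}|lebesgue. h \<theta>) = (LINT \<theta>|circ. h \<theta>)" .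
qed

text \<open>Cutting f off outside [0, 2 pi] gives a measurable function on the whole line, whose
  reflection is measurable too; the two branches of \<open>phi\<close> are built from these.\<close>

lemma phi_measurable:
  assumes f: "integrable circ f" and per: "\<And>\<theta>. f (\<theta> + 2 * pi) = f \<theta>"
  shows "phi (\<lambda>t. cmod (f t)) \<in> borel_measurable (lebesgue_on {-2*pi..2*pi})"
proof -
  define g where "g \<theta> = indicator {0..2*pi} \<theta> *\<^sub>R f \<theta>" for \<theta>
  have g: "g \<in> borel_measurable lebesgue"
    using periodic_set_integral(1)[OF f per] unfolding set_integrable_def g_def
    by (rule borel_measurable_integrable)
  have g': "(\<lambda>\<theta>. g (- \<theta>)) \<in> borel_measurable lebesgue"
    using borel_measurable_affine[OF g, of "-1" 0] by simp
  have "(\<lambda>\<theta>. if \<theta> \<in> {0..2*pi} then cmod (g \<theta>) else - cmod (g (- \<theta>))) \<in> borel_measurable lebesgue"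
    using g g' by (intro measurable_If borel_measurable_uminus borel_measurable_norm) auto
  then have meas: "(\<lambda>\<theta>. if \<theta> \<in> {0..2*pi} then cmod (g \<theta>) else - cmod (g (- \<theta>))) \<in> borel_measurable (lebesgue_on {-2*pi..2*pi})"
    by (rule measurable_restrict_space1)
  have eq: "phi (\<lambda>t. cmod (f t)) \<theta> = (if \<theta> \<in> {0..2*pi} then cmod (g \<theta>) else - cmod (g (- \<theta>)))"
    if "\<theta> \<in> space (lebesgue_on {-2*pi..2*pi})" for \<theta>
    using that by (auto simp: phi_def g_def indicator_def)
  show ?thesis by (rule measurable_cong[THEN iffD2, OF eq meas])
qed

text \<open>The right half of the domain contributes F(|f|); the left half, once reflected,
  contributes F(-|f|). The auxiliary \<open>h s\<close> with s = 1 and s = -1 treats both.\<close>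

lemma phi_integral:
  assumes f: "integrable circ f" and per: "\<And>\<theta>. f (\<theta> + 2 * pi) = f \<theta>"
    and F: "continuous_on UNIV F" and B: "\<And>z. cmod (F z) \<le> B"
  shows "(LINT \<theta>:{-2*pi..2*pi}|lebesgue. F (complex_of_real (phi (\<lambda>t. cmod (f t)) \<theta>))) =
    (LINT \<theta>|circ. F (complex_of_real (cmod (f \<theta>))) + F (complex_of_real (- cmod (f \<theta>))))"
proof -
  have [measurable]: "f \<in> borel_measurable circ" using f by auto
  let ?\<phi> = "\<lambda>\<theta>. F (complex_of_real (phi (\<lambda>t. cmod (f t)) \<theta>))"
  define h where "h s \<theta> = F (complex_of_real (s * cmod (f \<theta>)))" for s :: real and \<theta>
  have h: "integrable circ (h s)" for s
    unfolding h_def by (intro integrable_circ_bounded_continuous[OF _ F B]) measurable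
  have h_per: "h s (\<theta> + 2 * pi) = h s \<theta>" for s \<theta> by (simp add: h_def per)
  note P = periodic_set_integral[OF h h_per]
  have neg: "indicator {-2*pi..<0} (0 + - 1 * \<theta>) *\<^sub>R ?\<phi> (0 + - 1 * \<theta>) = indicator {0<..2*pi} \<theta> *\<^sub>R h (- 1) \<theta>" for \<theta>
    by (auto simp: indicator_def phi_def h_def)
  have I0: "set_integrable lebesgue {0<..2*pi} (h (- 1))"
    by (rule set_integrable_subset[OF P(1)]) auto
  have L: "set_integrable lebesgue {-2*pi..<0} ?\<phi>"
    using I0 lebesgue_integrable_real_affine_iff[of "-1" "\<lambda>\<theta>. indicator {-2*pi..<0} \<theta> *\<^sub>R ?\<phi> \<theta>" 0]
    unfolding set_integrable_def neg by simp
  have "(LINT \<theta>:{-2*pi..<0}|lebesgue. ?\<phi> \<theta>) = (LINT \<theta>:{0<..2*pi}|lebesgue. h (- 1) \<theta>)"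
    using lebesgue_integral_real_affine[of "-1" "\<lambda>\<theta>. indicator {-2*pi..<0} \<theta> *\<^sub>R ?\<phi> \<theta>" 0]
    unfolding set_lebesgue_integral_def neg by simp
  \<comment> \<open>Reflection sends [-2 pi, 0) to (0, 2 pi]; the missing point 0 is null.\<close>
  also have "\<dots> = (LINT \<theta>:{0..2*pi}|lebesgue. h (- 1) \<theta>)"
    by (rule set_integral_discrete_difference[of "{0}"]) auto
  finally have L_eq: "(LINT \<theta>:{-2*pi..<0}|lebesgue. ?\<phi> \<theta>) = (LINT \<theta>|circ. h (- 1) \<theta>)" by (simp add: P(2))
  have R: "set_integrable lebesgue {0..2*pi} ?\<phi>"
    using P(1)[of 1] by (rule set_integrable_cong[THEN iffD1, rotated 3]) (auto simp: h_def phi_def)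
  have R_eq: "(LINT \<theta>:{0..2*pi}|lebesgue. ?\<phi> \<theta>) = (LINT \<theta>|circ. h 1 \<theta>)"
    unfolding P(2)[of 1, symmetric] by (rule set_lebesgue_integral_cong) (auto simp: h_def phi_def)
  have split: "{-2*pi..2*pi} = {-2*pi..<0} \<union> {0..2*pi}" using pi_gt_zero by (auto simp del: pi_gt_zero)
  have disj: "{-2*pi..<0} \<inter> {0..2*pi} = {}" by auto
  have "(LINT \<theta>:{-2*pi..2*pi}|lebesgue. ?\<phi> \<theta>) = (LINT \<theta>|circ. h (- 1) \<theta>) + (LINT \<theta>|circ. h 1 \<theta>)"
    unfolding split by (simp only: set_integral_Un[OF disj L R] L_eq R_eq)
  also have "\<dots> = (LINT \<theta>|circ. h 1 \<theta> + h (- 1) \<theta>)"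
    using h by simp
  finally show ?thesis by (simp add: h_def)
qed

theorem corollary3p3:
  fixes f :: "real \<Rightarrow> complex"
  assumes "set_integrable lebesgue {-pi..pi} f"
    and "\<And>\<theta>. f (\<theta> + 2 * pi) = f \<theta>"
    and "\<And>k. fourier_coeff f k \<in> \<real>"
  shows "eigenvalue_distribution (\<lambda>n. flip_mat n * toeplitz_mat n f)
           (\<lambda>\<theta>. complex_of_real (phi (\<lambda>t. cmod (f t)) \<theta>)) {-2*pi..2*pi}"
proof -
  note per = assms(2) and f_real = assms(3)
  have f: "integrable circ f" using assms(1) by (simp add: integrable_circ_iff)
  have meas: "measure lebesgue {-2*pi..2*pi} = 4 * pi" by simp
  have "(\<lambda>\<theta>. complex_of_real (phi (\<lambda>t. cmod (f t)) \<theta>)) \<in> borel_measurable (lebesgue_on {-2*pi..2*pi})"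
    by (rule measurable_compose[OF phi_measurable[OF f per] borel_measurable_of_real_cnj(1)])
  moreover have "(\<lambda>n. 1 / of_nat n * (\<Sum>z\<in>#eigenvalues_mset (flip_mat n * toeplitz_mat n f). F z))
      \<longlonglongrightarrow> 1 / complex_of_real (measure lebesgue {-2*pi..2*pi}) *
        (LINT \<theta>:{-2*pi..2*pi}|lebesgue. F (complex_of_real (phi (\<lambda>t. cmod (f t)) \<theta>)))"
    if F: "continuous_on UNIV F" and supp: "bounded {z. F z \<noteq> 0}" for F :: "complex \<Rightarrow> complex"
  proof -
    obtain B where B: "\<And>z. cmod (F z) \<le> B" using bounded_support_bounded[OF F supp] by blast
    \<comment> \<open>The eigenvalues are real, so evaluating \<open>F\<close> at z or at its real
      part gives the same sum.\<close>
    have "1 / of_nat n * (\<Sum>z\<in>#eigenvalues_mset (flip_mat n * toeplitz_mat n f). F z)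
        = ev_mean f n (\<lambda>x. F (complex_of_real x))" for n
      by (rule ev_mean_eigenbasis[where f = f and n = n, OF f_real]) simp
    then show ?thesis
      using ev_mean_limit[OF f f_real F supp]
      unfolding meas phi_integral[OF f per F B] limit_mean_def by simp
  qed
  ultimately show ?thesis
    unfolding eigenvalue_distribution_def
    by (auto simp: flip_mat_def toeplitz_mat_def lmeasurable_cbox[of "-2*pi" "2*pi", simplified])
qed

end
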